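(* Let $i,j$ be two non-negative real numbers with $i>j$ and $i+j=1$. Let $\hat{w}$ be a real number with $\hat{w}>6i$ and let $$\hat{\lambda}\in\left(\frac{1}{2i}\left(1-\frac{2j}{\hat{w}}\right),\ \min\left(\frac{1}{2i},\ \frac{1}{2j}\left(1-\frac{2i}{\hat{w}}\right)\right)\right).$$ Then there exist uncountably many $\boldsymbol{\theta}=(\theta_1,\theta_2)\in\mathbb{R}^2$, with $1,\theta_1,\theta_2$ linearly independent over $\mathbb{Q}$, such that $\hat{\omega}_{i,j}(\boldsymbol{\theta})=\hat{w}$ and $\hat{\lambda}_{i,j}(\boldsymbol{\theta})=\hat{\lambda}$.
   Context: **Twisted uniform exponents.** Let $\boldsymbol{\theta}=(\theta_1,\theta_2)\in\mathbb{R}^2$ with $1,\theta_1,\theta_2$ linearly independent over $\mathbb{Q}$, and let $i,j\ge0$ be real with $i+j=1$. The uniform exponent $\hat{\omega}_{i,j}(\boldsymbol{\theta})$ is the supremum of the real numbers $\nu$ such that, for every sufficiently large real $H$, the system $$0<|q-p_1\theta_1-p_2\theta_2|\le H^{-\nu},\quad |p_1|\le H^{2i},\quad |p_2|\le H^{2j}$$ has an integer solution $(p_1,p_2,q)$ with $(p_1,p_2)\ne(0,0)$. The uniform exponent $\hat{\lambda}_{i,j}(\boldsymbol{\theta})$ is the supremum of the real numbers $\nu$ such that, for every sufficiently large real $H$, the system $$0<|q|\le H,\quad |q\theta_1-p_1|\le H^{-2i\nu},\quad |q\theta_2-p_2|\le H^{-2j\nu}$$ has an integer solution $(p_1,p_2,q)$.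 *)

theory Defs
  imports "HOL-Library.Extended_Real" "HOL-Library.Countable_Set"
begin

text \<open>
  The vectors \<open>1\<close>, \<open>\<theta>\<^sub>1\<close>, \<open>\<theta>\<^sub>2\<close> are a family, while the library predicate is about sets, so their
  distinctness has to be required separately.
\<close>

definition indep_over_rat :: "real \<times> real \<Rightarrow> bool" where
  "indep_over_rat \<theta> \<longleftrightarrow> distinct [1, fst \<theta>, snd \<theta>] \<and>
     module.independent (\<lambda>(r::rat) (x::real). of_rat r * x) {1, fst \<theta>, snd \<theta>}"

lemma module_rat_real: "module (\<lambda>(r::rat) (x::real). of_rat r * x)"
  by standard (simp_all add: of_rat_add of_rat_mult distrib_left distrib_right)

lemma indep_over_rat_iff:
  "indep_over_rat (t1, t2) \<longleftrightarrow>
     (\<forall>a b c :: rat. of_rat a + of_rat b * t1 + of_rat c * t2 = (0::real) \<longrightarrow>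
        a = 0 \<and> b = 0 \<and> c = 0)"
proof -
  interpret module "\<lambda>(r::rat) (x::real). of_rat r * x"
    by (rule module_rat_real)
  have fin: "finite {1, t1, t2}" by simp
  show ?thesis
  proof (intro iffI allI impI)
    fix a b c :: rat
    assume L: "indep_over_rat (t1, t2)"
      and e: "of_rat a + of_rat b * t1 + of_rat c * t2 = (0::real)"
    from L have d: "1 \<noteq> t1" "1 \<noteq> t2" "t1 \<noteq> t2" and ind: "independent {1, t1, t2}"
      by (simp_all add: indep_over_rat_def)
    define u where "u = (\<lambda>x. if x = 1 then a else if x = t1 then b else c)"
    have u: "u 1 = a" "u t1 = b" "u t2 = c"
      using d by (simp_all add: u_def)
    have "(\<Sum>v\<in>{1, t1, t2}. of_rat (u v) * v) = 0"
      using d e by (simp add: u add.assoc)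
    with ind have "\<forall>v\<in>{1, t1, t2}. u v = 0"
      unfolding dependent_finite[OF fin] by blast
    then show "a = 0 \<and> b = 0 \<and> c = 0" by (simp add: u)
  next
    assume R: "\<forall>a b c :: rat. of_rat a + of_rat b * t1 + of_rat c * t2 = (0::real) \<longrightarrow>
        a = 0 \<and> b = 0 \<and> c = 0"
    have d: "1 \<noteq> t1" "1 \<noteq> t2" "t1 \<noteq> t2"
      using R[rule_format, of 1 "-1" 0] R[rule_format, of 1 0 "-1"] R[rule_format, of 0 1 "-1"]
      by (auto simp: of_rat_minus)
    have "u 1 = 0 \<and> u t1 = 0 \<and> u t2 = 0" if "(\<Sum>v\<in>{1, t1, t2}. of_rat (u v) * v) = 0" for u
      using R[rule_format, of "u 1" "u t1" "u t2"] that d by (simp add: add.assoc)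
    then have "independent {1, t1, t2}"
      unfolding dependent_finite[OF fin] by blast
    with d show "indep_over_rat (t1, t2)" by (simp add: indep_over_rat_def)
  qed
qed

text \<open>
  The exponents may be infinite, hence the suprema are taken in the extended reals.
\<close>

definition omega_hat :: "real \<Rightarrow> real \<Rightarrow> real \<times> real \<Rightarrow> ereal" where
  "omega_hat i j \<theta> = Sup (ereal ` {\<nu>::real. \<forall>\<^sub>F H::real in at_top.
     \<exists>p1 p2 q :: int. (p1, p2) \<noteq> (0, 0) \<and>
       0 < \<bar>of_int q - of_int p1 * fst \<theta> - of_int p2 * snd \<theta>\<bar> \<and>
       \<bar>of_int q - of_int p1 * fst \<theta> - of_int p2 * snd \<theta>\<bar> \<le> H powr (- \<nu>) \<and>
       \<bar>of_int p1\<bar> \<le> H powr (2 * i) \<and> \<bar>of_int p2\<bar> \<le> H powr (2 * j)})"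

definition lambda_hat :: "real \<Rightarrow> real \<Rightarrow> real \<times> real \<Rightarrow> ereal" where
  "lambda_hat i j \<theta> = Sup (ereal ` {\<nu>::real. \<forall>\<^sub>F H::real in at_top.
     \<exists>p1 p2 q :: int. 0 < \<bar>q\<bar> \<and> \<bar>of_int q\<bar> \<le> H \<and>
       \<bar>of_int q * fst \<theta> - of_int p1\<bar> \<le> H powr (- (2 * i * \<nu>)) \<and>
       \<bar>of_int q * snd \<theta> - of_int p2\<bar> \<le> H powr (- (2 * j * \<nu>))})"

end

theory Submission imports Defs begin

text \<open>
  Write \<open>a = 2i\<close> and \<open>b = 2j\<close>, so that \<open>a + b = 2\<close> and \<open>b < 1 < a\<close>, and put
  \<open>s = w (1 - a l)\<close> and \<open>g = w l\<close>.  The hypothesis on \<open>l\<close> says exactly that \<open>0 < s < b\<close> and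
  \<open>b l w < w - a\<close>; moreover \<open>w = s + a g\<close>.

  The point \<open>\<theta>\<close> is built together with its sequence of good linear forms.  These are integer
  vectors \<open>v\<^sub>k = (x\<^sub>k, y\<^sub>k, z\<^sub>k)\<close>, three consecutive ones always having determinant \<open>1\<close>, with
  \<open>x\<^sub>k \<asymp> H\<^sub>k powr a\<close> and \<open>y\<^sub>k \<asymp> H\<^sub>k powr s\<close>, where \<open>H\<^sub>k\<^sub>+\<^sub>1 = H\<^sub>k powr g\<close>.  The first coordinate fills
  the whole box \<open>\<bar>p\<^sub>1\<bar> \<le> H powr a\<close>, while the second one deliberately stays below \<open>H powr b\<close>; this
  choice of \<open>s < b\<close> is what decouples the two exponents.

  The cross product \<open>u\<^sub>k = (N\<^sub>k, R\<^sub>k, S\<^sub>k)\<close> of \<open>v\<^sub>k\<close> and \<open>v\<^sub>k\<^sub>+\<^sub>1\<close> has \<open>N\<^sub>k \<asymp> W\<^sub>k = H\<^sub>k\<^sub>+\<^sub>1 powr a * H\<^sub>k powr s\<close>,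
  which is \<open>H\<^sub>k powr w\<close>.  Since \<open>u\<^sub>k\<^sub>+\<^sub>1\<close> pairs with \<open>v\<^sub>k\<close> to \<open>-1\<close>, the rational points
  \<open>(R\<^sub>k / N\<^sub>k, S\<^sub>k / N\<^sub>k)\<close> converge fast to a limit \<open>\<theta>\<close> at which the linear form \<open>L\<^sub>k\<close> of \<open>v\<^sub>k\<close> has
  size \<open>\<asymp> 1 / N\<^sub>k\<^sub>+\<^sub>1 \<asymp> H\<^sub>k\<^sub>+\<^sub>1 powr (- w)\<close>.  The errors of \<open>u\<^sub>k\<close> at \<open>\<theta>\<close> are determinants in the
  coordinates of \<open>v\<^sub>k, v\<^sub>k\<^sub>+\<^sub>1\<close> and \<open>L\<^sub>k, L\<^sub>k\<^sub>+\<^sub>1\<close>: the first is \<open>\<asymp> H\<^sub>k\<^sub>+\<^sub>1 powr (s - w)\<close>, which is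
  \<open>(H\<^sub>k\<^sub>+\<^sub>1 powr w) powr (- a l)\<close>, and the second is at most a constant times \<open>H\<^sub>k\<^sub>+\<^sub>1 powr (a - w)\<close>.

  Hence \<open>v\<^sub>k\<close> solves the first system for \<open>H\<close> between (multiples of) \<open>H\<^sub>k\<close> and \<open>H\<^sub>k\<^sub>+\<^sub>1\<close> with every
  exponent below \<open>w\<close>, and \<open>u\<^sub>k\<close> solves the second one for \<open>H\<close> between \<open>W\<^sub>k\<close> and \<open>W\<^sub>k\<^sub>+\<^sub>1\<close> with every
  exponent below \<open>l\<close>.  Conversely, just below \<open>H\<^sub>k\<^sub>+\<^sub>1\<close>, respectively \<open>W\<^sub>k\<^sub>+\<^sub>1\<close>, nothing does better: the
  integer pairing of a better solution with \<open>u\<^sub>k\<close>, respectively with \<open>v\<^sub>k\<close> and \<open>v\<^sub>k\<^sub>+\<^sub>1\<close>, has absolute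
  value below \<open>1\<close> and so vanishes.  The solution then lies in the span of \<open>v\<^sub>k\<close> and \<open>v\<^sub>k\<^sub>+\<^sub>1\<close>,
  respectively is a multiple of \<open>u\<^sub>k\<close>, and its actual size contradicts the assumption.

  At each step of the construction there is a free binary choice, and different choices lead to
  different \<open>\<theta>\<close>; this gives uncountably many points.
\<close>

section \<open>Points approximated by chains of integer vectors\<close>

lemma divide_antimono:
  fixes u v c :: real
  assumes "0 < u" "u \<le> v" "0 \<le> c"
  shows "c / v \<le> c / u"
  using assms by (intro divide_left_mono) auto

lemma geometric_steps_limit:
  fixes f e :: "nat \<Rightarrow> real"
  assumes step: "\<And>k. \<bar>f (Suc k) - f k\<bar> \<le> e k" and dec: "\<And>k. e (Suc k) \<le> e k / 2"
  shows "\<bar>lim f - f k\<bar> \<le> 2 * e k"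
proof -
  have e0: "0 \<le> e k" for k
    using step[of k] by linarith
  have bound: "\<bar>f (k + n) - f k\<bar> \<le> 2 * e k - 2 * e (k + n)" for k n
  proof (induction n)
    case (Suc n)
    show ?case
      using Suc step[of "k + n"] dec[of "k + n"] by simp
  qed simp
  have e_small: "e k \<le> e 0 * (1/2) ^ k" for k
  proof (induction k)
    case (Suc k)
    then show ?case using dec[of k] by simp
  qed simp
  have "(\<lambda>k. e 0 * (1/2::real) ^ k) \<longlonglongrightarrow> e 0 * 0"
    by (intro tendsto_mult tendsto_const LIMSEQ_power_zero) simp
  then have e_lim: "e \<longlonglongrightarrow> 0"
    using e_small e0 by (intro tendsto_sandwich[of "\<lambda>_. 0" e _ "\<lambda>k. e 0 * (1/2) ^ k"]) auto
  have "Cauchy f"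
  proof (rule metric_CauchyI)
    fix \<epsilon> :: real assume "0 < \<epsilon>"
    then have "\<forall>\<^sub>F k in sequentially. e k < \<epsilon> / 4"
      using order_tendstoD(2)[OF e_lim, of "\<epsilon> / 4"] by simp
    then obtain M where M: "e M < \<epsilon> / 4"
      by (auto simp: eventually_sequentially)
    have near: "\<bar>f m - f M\<bar> < \<epsilon> / 2" if "m \<ge> M" for m
      using bound[of M "m - M"] e0[of m] M that by simp
    have "dist (f m) (f n) < \<epsilon>" if "m \<ge> M" "n \<ge> M" for m n
      using near[OF that(1)] near[OF that(2)] unfolding dist_real_def by linarith
    then show "\<exists>M. \<forall>m\<ge>M. \<forall>n\<ge>M. dist (f m) (f n) < \<epsilon>"
      by blast
  qed
  then have lim: "f \<longlonglongrightarrow> lim f"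
    by (simp add: Cauchy_convergent convergent_LIMSEQ_iff[symmetric])
  show ?thesis
  proof (rule tendsto_upperbound)
    show "(\<lambda>n. \<bar>f (n + k) - f k\<bar>) \<longlonglongrightarrow> \<bar>lim f - f k\<bar>"
      by (intro tendsto_intros LIMSEQ_ignore_initial_segment lim)
    show "\<forall>\<^sub>F n in sequentially. \<bar>f (n + k) - f k\<bar> \<le> 2 * e k"
      using bound[of k] e0 by (intro always_eventually) (smt (verit) add.commute)
  qed simp
qed

text \<open>
  The factor \<open>1000\<close> has no significance beyond making all error terms in the estimates below
  negligible against the main terms.
\<close>

locale fast_growth =
  fixes X Y :: "nat \<Rightarrow> real"
  assumes X_ge1: "1 \<le> X k" and Y_ge1: "1 \<le> Y k"
    and X_grow: "1000 * X k \<le> X (Suc k)" and Y_grow: "1000 * Y k \<le> Y (Suc k)"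
    and ratio_grow: "1000 * (X k * Y (Suc k)) \<le> X (Suc k) * Y k"
begin

lemma X_pos: "0 < X k" and Y_pos: "0 < Y k"
  using X_ge1[of k] Y_ge1[of k] by linarith+

end

text \<open>
  The triple \<open>(x k, y k, z k)\<close> stands for the linear form \<open>z k - x k * \<theta>\<^sub>1 - y k * \<theta>\<^sub>2\<close>.  By \<open>ratio_grow\<close>
  the vectors \<open>(x k, y k)\<close> turn towards the first axis, so the minor \<open>N\<close> of two consecutive ones is
  dominated by the single product \<open>x (k+1) * y k\<close>.
\<close>

locale approx_chain = fast_growth X Y for X Y :: "nat \<Rightarrow> real" +
  fixes x y z :: "nat \<Rightarrow> int"
  assumes x_lower: "X k / 2 \<le> x k" and x_upper: "x k \<le> 3/2 * X k"
    and y_lower: "Y k / 2 \<le> y k" and y_upper: "y k \<le> 3/2 * Y k"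
    and unimodular:
      "x k * (y (k+1) * z (k+2) - z (k+1) * y (k+2)) -
       y k * (x (k+1) * z (k+2) - z (k+1) * x (k+2)) +
       z k * (x (k+1) * y (k+2) - y (k+1) * x (k+2)) = 1"
begin

text \<open>
  \<open>(N k, R k, S k)\<close> is the cross product of two consecutive vectors, with signs such that it is
  orthogonal to both for the pairing \<open>\<langle>(n, p, r), (x, y, z)\<rangle> = n z - p x - r y\<close>.
\<close>

definition N :: "nat \<Rightarrow> int" where "N k = x (k+1) * y k - x k * y (k+1)"
definition R :: "nat \<Rightarrow> int" where "R k = z (k+1) * y k - z k * y (k+1)"
definition S :: "nat \<Rightarrow> int" where "S k = x (k+1) * z k - x k * z (k+1)"
definition W :: "nat \<Rightarrow> real" where "W k = X (k+1) * Y k"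

lemma next_pairing: "N (k+1) * z k - R (k+1) * x k - S (k+1) * y k = - 1"
  using unimodular[of k] unfolding N_def R_def S_def
  by (simp add: algebra_simps)

text \<open>
  The cross product of two consecutive cross products is the common vector again, up to the
  determinant, which is \<open>1\<close>.  This is why consecutive rational points are so close to each other.
\<close>

lemma R_N_step: "R (k+1) * N k - R k * N (k+1) = - y (k+1)"
  and S_N_step: "S (k+1) * N k - S k * N (k+1) = x (k+1)"
proof -
  have "R (k+1) * N k - R k * N (k+1) = - y (k+1) *
     (x k * (y (k+1) * z (k+2) - z (k+1) * y (k+2)) -
       y k * (x (k+1) * z (k+2) - z (k+1) * x (k+2)) +
       z k * (x (k+1) * y (k+2) - y (k+1) * x (k+2)))"
    unfolding N_def R_def S_def by (simp add: algebra_simps)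
  then show "R (k+1) * N k - R k * N (k+1) = - y (k+1)"
    by (simp only: unimodular mult_1_right)
  have "S (k+1) * N k - S k * N (k+1) = x (k+1) *
     (x k * (y (k+1) * z (k+2) - z (k+1) * y (k+2)) -
       y k * (x (k+1) * z (k+2) - z (k+1) * x (k+2)) +
       z k * (x (k+1) * y (k+2) - y (k+1) * x (k+2)))"
    unfolding N_def R_def S_def by (simp add: algebra_simps)
  then show "S (k+1) * N k - S k * N (k+1) = x (k+1)"
    by (simp only: unimodular mult_1_right)
qed

text \<open>
  Three consecutive vectors form a basis of the integer lattice; pairing with \<open>(N k, R k, S k)\<close>
  extracts the coefficient of the third one.
\<close>

lemma vector_in_basis:
  fixes p r q :: int
  assumes "N k * q - R k * p - S k * r = 0"
  obtains c d where "p = c * x k + d * x (k+1)" "r = c * y k + d * y (k+1)" "q = c * z k + d * z (k+1)"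
    and "c = - (N (k+1) * q - R (k+1) * p - S (k+1) * r)"
proof -
  define c where "c = - (N (k+1) * q - R (k+1) * p - S (k+1) * r)"
  define d where "d = x k * (r * z (k+2) - q * y (k+2)) - y k * (p * z (k+2) - q * x (k+2)) +
       z k * (p * y (k+2) - r * x (k+2))"
  define D where "D = x k * (y (k+1) * z (k+2) - z (k+1) * y (k+2)) -
       y k * (x (k+1) * z (k+2) - z (k+1) * x (k+2)) +
       z k * (x (k+1) * y (k+2) - y (k+1) * x (k+2))"
  have D: "D = 1" using unimodular[of k] by (simp add: D_def)
  have "D * p = c * x k + d * x (k+1) - (N k * q - R k * p - S k * r) * x (k+2)"
    "D * r = c * y k + d * y (k+1) - (N k * q - R k * p - S k * r) * y (k+2)"
    "D * q = c * z k + d * z (k+1) - (N k * q - R k * p - S k * r) * z (k+2)"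
    unfolding D_def c_def d_def N_def R_def S_def by (simp_all add: algebra_simps)
  then show thesis
    using assms unfolding D by (intro that[OF _ _ _ c_def, of d]) simp_all
qed

text \<open>
  The dual statement: the vectors orthogonal to \<open>v\<^sub>k\<close> and \<open>v\<^sub>k\<^sub>+\<^sub>1\<close> are the integer multiples of
  their cross product, which is primitive because the determinant is \<open>1\<close>.
\<close>

lemma dual_vector_multiple:
  fixes n p r :: int
  assumes "n * z k - p * x k - r * y k = 0" "n * z (k+1) - p * x (k+1) - r * y (k+1) = 0"
  obtains m where "n = m * N k" "p = m * R k" "r = m * S k"
proof -
  define m where "m = - (n * z (k+2) - p * x (k+2) - r * y (k+2))"
  define D where "D = x k * (y (k+1) * z (k+2) - z (k+1) * y (k+2)) -
       y k * (x (k+1) * z (k+2) - z (k+1) * x (k+2)) +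
       z k * (x (k+1) * y (k+2) - y (k+1) * x (k+2))"
  have D: "D = 1" using unimodular[of k] by (simp add: D_def)
  have eqs: "D * n = m * N k + (n * z k - p * x k - r * y k) * (x (k+1) * y (k+2) - y (k+1) * x (k+2))
       + (n * z (k+1) - p * x (k+1) - r * y (k+1)) * (x (k+2) * y k - x k * y (k+2))"
    "D * p = m * R k + (n * z k - p * x k - r * y k) * (z (k+1) * y (k+2) - y (k+1) * z (k+2))
       + (n * z (k+1) - p * x (k+1) - r * y (k+1)) * (z (k+2) * y k - z k * y (k+2))"
    "D * r = m * S k + (n * z k - p * x k - r * y k) * (x (k+1) * z (k+2) - z (k+1) * x (k+2))
       + (n * z (k+1) - p * x (k+1) - r * y (k+1)) * (x (k+2) * z k - x k * z (k+2))"
    unfolding D_def m_def N_def R_def S_def by (simp_all add: algebra_simps)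
  have "n = m * N k" "p = m * R k" "r = m * S k"
    using eqs unfolding D assms by simp_all
  then show thesis by (rule that)
qed

lemma W_pos: "0 < W k"
  unfolding W_def using X_pos[of "k+1"] Y_pos[of k] by simp

lemma W_grow: "1000000 * W k \<le> W (Suc k)"
proof -
  have "(1000 * X (k+1)) * (1000 * Y k) \<le> X (k+2) * Y (k+1)"
    using X_grow[of "k+1"] Y_grow[of k] X_ge1[of "k+1"] X_ge1[of "k+2"] Y_ge1[of k] by (intro mult_mono) auto
  then show ?thesis unfolding W_def by (simp add: numeral_2_eq_2)
qed

lemma N_lower: "W k / 8 \<le> N k" and N_upper: "N k \<le> 8 * W k"
proof -
  have xy: "0 \<le> real_of_int (x j)" "0 \<le> real_of_int (y j)" for j
    using x_lower[of j] X_ge1[of j] y_lower[of j] Y_ge1[of j] by linarith+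
  have pos: "0 < X j" "0 < Y j" for j
    using X_ge1[of j] Y_ge1[of j] by linarith+
  have N: "real_of_int (N k) = x (k+1) * y k - x k * y (k+1)"
    by (simp add: N_def)
  have l: "(X (k+1) / 2) * (Y k / 2) \<le> real_of_int (x (k+1)) * y k"
    using x_lower y_lower pos xy by (intro mult_mono) (auto simp: less_imp_le)
  have u: "real_of_int (x (k+1)) * y k \<le> (3/2 * X (k+1)) * (3/2 * Y k)"
    using x_upper y_upper pos xy by (intro mult_mono) (auto simp: less_imp_le)
  have v: "real_of_int (x k) * y (k+1) \<le> (3/2 * X k) * (3/2 * Y (k+1))"
    using x_upper y_upper pos xy by (intro mult_mono) (auto simp: less_imp_le)
  have v0: "0 \<le> real_of_int (x k) * y (k+1)"
    using xy by simp
  have r: "1000 * (X k * Y (k+1)) \<le> W k"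
    using ratio_grow[of k] by (simp add: W_def)
  show "W k / 8 \<le> N k"
    using l v r W_pos[of k] unfolding N W_def[symmetric] by (simp add: W_def)
  show "N k \<le> 8 * W k"
    using u v0 W_pos[of k] unfolding N by (simp add: W_def)
qed

lemma N_pos: "0 < N k"
proof -
  have "0 < real_of_int (N k)"
    using N_lower[of k] W_pos[of k] by linarith
  then show ?thesis by simp
qed

definition \<theta>1 :: real where "\<theta>1 = lim (\<lambda>k. R k / N k)"
definition \<theta>2 :: real where "\<theta>2 = lim (\<lambda>k. S k / N k)"

text \<open>
  This serves both coordinates: \<open>r\<close> is \<open>R\<close> or \<open>S\<close>, and \<open>u\<close> is \<open>y (k+1)\<close> or \<open>x (k+1)\<close>.
\<close>

lemma step_bound:
  fixes r :: "nat \<Rightarrow> int" and u U :: real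
  assumes "\<bar>r (k+1) * N k - r k * N (k+1)\<bar> = u" "u \<le> 3/2 * U" "0 \<le> U"
  shows "\<bar>r (Suc k) / N (Suc k) - r k / N k\<bar> \<le> 100 * U / (W k * W (k+1))"
proof -
  have n: "0 < real_of_int (N k)" "0 < real_of_int (N (k+1))"
    using N_pos by simp_all
  have "r (k+1) / N (k+1) - r k / N k = (r (k+1) * N k - r k * N (k+1)) / (N k * N (k+1))"
    using n by (simp add: field_simps)
  then have "\<bar>r (k+1) / N (k+1) - r k / N k\<bar> = u / (real_of_int (N k) * real_of_int (N (k+1)))"
    using n assms(1) by (simp add: abs_mult)
  also have "\<dots> \<le> (3/2 * U) / (W k / 8 * (W (k+1) / 8))"
  proof (rule frac_le)
    show "W k / 8 * (W (k+1) / 8) \<le> real_of_int (N k) * real_of_int (N (k+1))"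
      using N_lower[of k] N_lower[of "k+1"] W_pos[of k] W_pos[of "k+1"] n by (intro mult_mono) auto
  qed (use assms W_pos[of k] W_pos[of "k+1"] in auto)
  also have "\<dots> = 96 * U / (W k * W (k+1))"
    by simp
  also have "\<dots> \<le> 100 * U / (W k * W (k+1))"
    using assms W_pos[of k] W_pos[of "k+1"] by (intro divide_right_mono) auto
  finally show ?thesis by simp
qed

lemma x_pos: "0 < x k" and y_pos: "0 < y k"
proof -
  have "0 < real_of_int (x k)" "0 < real_of_int (y k)"
    using x_lower[of k] y_lower[of k] X_pos[of k] Y_pos[of k] by linarith+
  then show "0 < x k" "0 < y k" by simp_all
qed

text \<open>
  The bound \<open>100 * Y (k+1) / (W k * W (k+1))\<close> for one step is \<open>100 / (X (k+2) * W k)\<close>, a form in which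
  its geometric decay is visible.
\<close>

lemma \<theta>1_approx: "\<bar>\<theta>1 - R k / N k\<bar> \<le> 200 / (X (k+2) * W k)"
proof -
  have "\<bar>\<theta>1 - R k / N k\<bar> \<le> 2 * (100 / (X (k+2) * W k))"
    unfolding \<theta>1_def
  proof (rule geometric_steps_limit)
    fix k
    have "\<bar>R (Suc k) / N (Suc k) - R k / N k\<bar> \<le> 100 * Y (k+1) / (W k * W (k+1))"
    proof (rule step_bound)
      show "\<bar>R (k+1) * N k - R k * N (k+1)\<bar> = real_of_int (y (k+1))"
        using y_pos[of "k+1"] R_N_step[of k] by simp
    qed (use y_upper[of "k+1"] Y_pos[of "k+1"] in auto)
    also have "\<dots> = 100 / (X (k+2) * W k)"
      using Y_pos[of "k+1"] by (simp add: W_def[of "Suc k"])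
    finally show "\<bar>R (Suc k) / N (Suc k) - R k / N k\<bar> \<le> 100 / (X (k+2) * W k)" .
    have "X (k+2) * (2 * W k) \<le> X (Suc k + 2) * W (Suc k)"
      using X_grow[of "k+2"] W_grow[of k] X_pos[of "k+2"] W_pos[of k] by (intro mult_mono) auto
    then have "100 / (X (Suc k + 2) * W (Suc k)) \<le> 100 / (X (k+2) * (2 * W k))"
      using X_pos[of "k+2"] W_pos[of k] by (intro divide_antimono) auto
    then show "100 / (X (Suc k + 2) * W (Suc k)) \<le> 100 / (X (k+2) * W k) / 2"
      by (simp add: mult.assoc mult.left_commute)
  qed
  then show ?thesis by simp
qed

lemma \<theta>2_approx: "\<bar>\<theta>2 - S k / N k\<bar> \<le> 200 / (Y k * W (k+1))"
proof -
  have "\<bar>\<theta>2 - S k / N k\<bar> \<le> 2 * (100 / (Y k * W (k+1)))"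
    unfolding \<theta>2_def
  proof (rule geometric_steps_limit)
    fix k
    have "\<bar>S (Suc k) / N (Suc k) - S k / N k\<bar> \<le> 100 * X (k+1) / (W k * W (k+1))"
    proof (rule step_bound)
      show "\<bar>S (k+1) * N k - S k * N (k+1)\<bar> = real_of_int (x (k+1))"
        using x_pos[of "k+1"] S_N_step[of k] by simp
    qed (use x_upper[of "k+1"] X_pos[of "k+1"] in auto)
    also have "\<dots> = 100 / (Y k * W (k+1))"
      using X_pos[of "k+1"] by (simp add: W_def[of k])
    finally show "\<bar>S (Suc k) / N (Suc k) - S k / N k\<bar> \<le> 100 / (Y k * W (k+1))" .
    have "Y k * (2 * W (k+1)) \<le> Y (Suc k) * W (Suc k + 1)"
      using Y_grow[of k] W_grow[of "k+1"] Y_pos[of k] W_pos[of "k+1"] by (intro mult_mono) auto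
    then have "100 / (Y (Suc k) * W (Suc k + 1)) \<le> 100 / (Y k * (2 * W (k+1)))"
      using Y_pos[of k] W_pos[of "k+1"] by (intro divide_antimono) auto
    then show "100 / (Y (Suc k) * W (Suc k + 1)) \<le> 100 / (Y k * W (k+1)) / 2"
      by (simp add: mult.assoc mult.left_commute)
  qed
  then show ?thesis by simp
qed

definition L :: "nat \<Rightarrow> real" where "L k = z k - x k * \<theta>1 - y k * \<theta>2"

text \<open>
  At the rational point with index \<open>k + 1\<close> the linear form takes exactly the value
  \<open>- 1 / N (k+1)\<close>; passing to the limit changes it by a small fraction of that.
\<close>

lemma L_approx: "\<bar>L k + 1 / N (k+1)\<bar> \<le> 1 / (1000 * W (k+1))"
proof -
  let ?a = "\<theta>1 - R (k+1) / N (k+1)" and ?b = "\<theta>2 - S (k+1) / N (k+1)"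
  have n: "0 < real_of_int (N (k+1))" using N_pos by simp
  have "of_int (N (k+1) * z k - R (k+1) * x k - S (k+1) * y k) = (- 1 :: real)"
    by (simp only: next_pairing)
  moreover have "z k - x k * (R (k+1) / N (k+1)) - y k * (S (k+1) / N (k+1)) =
      of_int (N (k+1) * z k - R (k+1) * x k - S (k+1) * y k) / N (k+1)"
    using n by (simp add: diff_divide_distrib mult.commute)
  ultimately have "z k - x k * (R (k+1) / N (k+1)) - y k * (S (k+1) / N (k+1)) = - 1 / N (k+1)"
    by simp
  then have "L k + 1 / N (k+1) = - (x k * ?a) - y k * ?b"
    unfolding L_def by (simp add: algebra_simps)
  then have "\<bar>L k + 1 / N (k+1)\<bar> \<le> x k * \<bar>?a\<bar> + y k * \<bar>?b\<bar>"
    using x_pos[of k] y_pos[of k] abs_triangle_ineq4[of "- (x k * ?a)" "y k * ?b"]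
    by (simp add: abs_mult)
  also have "\<dots> \<le> (3/2 * X k) * (200 / (X (k+3) * W (k+1))) + (3/2 * Y k) * (200 / (Y (k+1) * W (k+2)))"
    using x_upper[of k] y_upper[of k] \<theta>1_approx[of "k+1"] \<theta>2_approx[of "k+1"] X_pos[of k] Y_pos[of k]
    by (intro add_mono mult_mono) (auto simp: numeral_3_eq_3 numeral_2_eq_2)
  also have "(3/2 * X k) * (200 / (X (k+3) * W (k+1))) \<le> 1 / (3000 * W (k+1))"
  proof -
    have "900000 * X k \<le> X (k+3)"
      using X_grow[of k] X_grow[of "k+1"] X_grow[of "k+2"] X_pos[of k]
      by (simp add: numeral_3_eq_3 numeral_2_eq_2)
    then show ?thesis
      using X_pos[of "k+3"] W_pos[of "k+1"] by (simp add: divide_simps)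
  qed
  also have "(3/2 * Y k) * (200 / (Y (k+1) * W (k+2))) \<le> 1 / (3000 * W (k+1))"
  proof -
    have "(3/2 * Y k) * (200 / (Y (k+1) * W (k+2))) \<le> (3/2 * Y k) * (200 / ((1000 * Y k) * (1000000 * W (k+1))))"
      using Y_grow[of k] W_grow[of "k+1"] Y_pos[of k] Y_pos[of "k+1"] W_pos[of "k+1"] W_pos[of "k+2"]
      by (intro mult_left_mono divide_antimono mult_mono) (auto simp: numeral_2_eq_2)
    also have "\<dots> \<le> 1 / (3000 * W (k+1))"
      using Y_pos[of k] W_pos[of "k+1"] by (simp add: divide_simps)
    finally show ?thesis .
  qed
  finally show ?thesis by (simp add: field_simps)
qed

lemma L_upper: "\<bar>L k\<bar> \<le> 16 / W (k+1)" and L_lower: "1 / (16 * W (k+1)) \<le> \<bar>L k\<bar>"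
proof -
  have n: "0 < real_of_int (N (k+1))" using N_pos by simp
  have "1 / (8 * W (k+1)) \<le> 1 / N (k+1)"
    using N_upper[of "k+1"] n by (intro divide_antimono) auto
  moreover have "1 / N (k+1) \<le> 1 / (W (k+1) / 8)"
    using N_lower[of "k+1"] W_pos[of "k+1"] by (intro divide_antimono) auto
  moreover define t where "t = 1 / W (k+1)"
  moreover have "0 < t" unfolding t_def using W_pos[of "k+1"] by simp
  ultimately have "t / 8 \<le> 1 / N (k+1)" "1 / N (k+1) \<le> 8 * t" "\<bar>L k + 1 / N (k+1)\<bar> \<le> t / 1000" "0 < t"
    using L_approx[of k] by (simp_all add: mult.commute)
  then have "\<bar>L k\<bar> \<le> 16 * t" "t / 16 \<le> \<bar>L k\<bar>"
    by linarith+
  then show "\<bar>L k\<bar> \<le> 16 / W (k+1)" "1 / (16 * W (k+1)) \<le> \<bar>L k\<bar>"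
    by (simp_all add: t_def mult.commute)
qed

lemma L_nz: "L k \<noteq> 0"
  using L_lower[of k] W_pos[of "k+1"] by (auto simp: divide_le_0_iff)

text \<open>
  Both approximation errors of \<open>(N k, R k, S k)\<close> are minors of the matrix with the columns
  \<open>(x, y, L)\<close>.  The term with \<open>L k\<close> dominates, since \<open>L (k+1)\<close> is much smaller.
\<close>

lemma first_error: "N k * \<theta>1 - R k = y (k+1) * L k - y k * L (k+1)"
  and second_error: "N k * \<theta>2 - S k = x k * L (k+1) - x (k+1) * L k"
  unfolding N_def R_def S_def L_def by (simp_all add: algebra_simps)

lemma
  shows first_error_upper: "\<bar>N k * \<theta>1 - R k\<bar> \<le> 64 * Y (k+1) / W (k+1)"
    and first_error_lower: "Y (k+1) / (64 * W (k+1)) \<le> \<bar>N k * \<theta>1 - R k\<bar>"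
    and second_error_upper: "\<bar>N k * \<theta>2 - S k\<bar> \<le> 64 * X (k+1) / W (k+1)"
proof -
  define t where "t = 1 / W (k+1)"
  have t: "0 < t" unfolding t_def using W_pos[of "k+1"] by simp
  have "16 / W (k+2) \<le> 16 / (1000000 * W (k+1))"
    using W_grow[of "k+1"] W_pos[of "k+1"] by (intro divide_antimono) (auto simp: numeral_2_eq_2)
  then have L': "\<bar>L (k+1)\<bar> \<le> t / 1000"
    using L_upper[of "k+1"] t by (simp add: t_def)
  have L: "\<bar>L k\<bar> \<le> 16 * t" "t / 16 \<le> \<bar>L k\<bar>"
    using L_upper[of k] L_lower[of k] by (simp_all add: t_def mult.commute)
  have *: "\<bar>u (k+1) * L k\<bar> \<le> 24 * (U (k+1) * t) \<and> U (k+1) * t / 32 \<le> \<bar>u (k+1) * L k\<bar>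
     \<and> \<bar>u k * L (k+1)\<bar> \<le> 3/2000 * (U (k+1) * t)"
    if u: "\<And>k. U k / 2 \<le> real_of_int (u k)" "\<And>k. real_of_int (u k) \<le> 3/2 * U k"
       "\<And>k. 0 < U k" "U k \<le> U (k+1)" for u :: "nat \<Rightarrow> int" and U
  proof -
    have pos: "0 < u j" for j
      using u(1)[of j] u(3)[of j] by (smt (verit) half_gt_zero of_int_0_less_iff)
    then have "0 < real_of_int (u k)" "0 < real_of_int (u (k+1))" by simp_all
    then have "\<bar>u (k+1) * L k\<bar> \<le> (3/2 * U (k+1)) * (16 * t) \<and> (U (k+1) / 2) * (t / 16) \<le> \<bar>u (k+1) * L k\<bar>
       \<and> \<bar>u k * L (k+1)\<bar> \<le> (3/2 * U (k+1)) * (t / 1000)"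
      unfolding abs_mult
      using L L' t u(1)[of "k+1"] u(2)[of "k+1"] u(2)[of k] u(3)[of k] u(3)[of "k+1"] u(4)
      by (intro conjI mult_mono) auto
    then show ?thesis by (simp add: mult_ac)
  qed
  have Y: "Y k \<le> Y (k+1)" and X: "X k \<le> X (k+1)"
    using X_grow[of k] Y_grow[of k] X_pos[of k] Y_pos[of k] by auto
  have pos: "0 < X (k+1) * t" "0 < Y (k+1) * t"
    using X_pos Y_pos t by simp_all
  have "\<bar>N k * \<theta>1 - R k\<bar> \<le> 64 * (Y (k+1) * t)" "Y (k+1) * t / 64 \<le> \<bar>N k * \<theta>1 - R k\<bar>"
    using *[of Y y, OF y_lower y_upper Y_pos Y] pos unfolding first_error by linarith+
  then show "\<bar>N k * \<theta>1 - R k\<bar> \<le> 64 * Y (k+1) / W (k+1)" "Y (k+1) / (64 * W (k+1)) \<le> \<bar>N k * \<theta>1 - R k\<bar>"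
    unfolding t_def by (simp_all add: mult.commute)
  have "\<bar>N k * \<theta>2 - S k\<bar> \<le> 64 * (X (k+1) * t)"
    using *[of X x, OF x_lower x_upper X_pos X] pos unfolding second_error by linarith
  then show "\<bar>N k * \<theta>2 - S k\<bar> \<le> 64 * X (k+1) / W (k+1)"
    unfolding t_def by (simp add: mult.commute)
qed

text \<open>
  The next two identities turn approximation properties into bounds for an integer.
\<close>

lemma pairing_eq:
  fixes p r q :: int
  shows "real_of_int (N k * q - R k * p - S k * r) =
    N k * (q - p * \<theta>1 - r * \<theta>2) + p * (N k * \<theta>1 - R k) + r * (N k * \<theta>2 - S k)"
  by (simp add: algebra_simps)

lemma dual_pairing_eq:
  fixes n p r :: int
  shows "real_of_int (n * z k - p * x k - r * y k) =
    n * L k + (n * \<theta>1 - p) * x k + (n * \<theta>2 - r) * y k"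
  unfolding L_def by (simp add: algebra_simps)

end


text \<open>
  If both chains had the same limit, the two linear forms with index \<open>k + 1\<close> would both be far
  smaller there than the common form with index \<open>k\<close>, of which their difference is a nonzero
  multiple.
\<close>

lemma chains_separate:
  assumes "approx_chain X Y x y z" "approx_chain X Y x' y' z'"
    and same: "x' k = x k" "y' k = y k" "z' k = z k"
    and succ: "x' (Suc k) = x (Suc k) + e * x k" "y' (Suc k) = y (Suc k) + e * y k"
      "z' (Suc k) = z (Suc k) + e * z k"
    and e: "e \<noteq> 0"
  shows "(approx_chain.\<theta>1 x y z, approx_chain.\<theta>2 x y z) \<noteq>
         (approx_chain.\<theta>1 x' y' z', approx_chain.\<theta>2 x' y' z')"
proof
  interpret A: approx_chain X Y x y z by fact
  interpret B: approx_chain X Y x' y' z' by fact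
  assume "(A.\<theta>1, A.\<theta>2) = (B.\<theta>1, B.\<theta>2)"
  then have "B.L (Suc k) - A.L (Suc k) = e * A.L k"
    unfolding A.L_def B.L_def succ by (simp add: algebra_simps)
  moreover have "\<bar>A.L k\<bar> \<le> \<bar>e * A.L k\<bar>"
    using e mult_right_mono[of 1 "real_of_int \<bar>e\<bar>" "\<bar>A.L k\<bar>"] by (simp add: abs_mult)
  ultimately have "\<bar>A.L k\<bar> \<le> \<bar>A.L (Suc k)\<bar> + \<bar>B.L (Suc k)\<bar>"
    by linarith
  also have "\<dots> \<le> 16 / A.W (k+2) + 16 / A.W (k+2)"
    using A.L_upper[of "Suc k"] B.L_upper[of "Suc k"]
    unfolding A.W_def B.W_def by (intro add_mono) (simp_all add: numeral_2_eq_2)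
  also have "16 / A.W (k+2) \<le> 16 / (1000000 * A.W (k+1))"
    using A.W_grow[of "k+1"] A.W_pos[of "k+1"] by (intro divide_antimono) (auto simp: numeral_2_eq_2)
  finally show False
    using A.L_lower[of k] A.W_pos[of "k+1"] by (simp add: field_simps)
qed

section \<open>Construction of chains with prescribed growth\<close>

text \<open>
  Cramer's rule, rounded down: the real numbers below the floor brackets solve
  \<open>s * (a\<^sub>1, b\<^sub>1) + t * (a\<^sub>2, b\<^sub>2) = (X, Y)\<close>.
\<close>

definition coeff1 :: "real \<Rightarrow> real \<Rightarrow> int \<times> int \<times> int \<Rightarrow> int \<times> int \<times> int \<Rightarrow> int" where
  "coeff1 X Y = (\<lambda>(a1, b1, _) (a2, b2, _).
     \<lfloor>(X * real_of_int b2 - Y * real_of_int a2) / (real_of_int a1 * real_of_int b2 - real_of_int b1 * real_of_int a2)\<rfloor>)"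

definition coeff2 :: "real \<Rightarrow> real \<Rightarrow> int \<times> int \<times> int \<Rightarrow> int \<times> int \<times> int \<Rightarrow> int" where
  "coeff2 X Y = (\<lambda>(a1, b1, _) (a2, b2, _).
     \<lfloor>(Y * real_of_int a1 - X * real_of_int b1) / (real_of_int a1 * real_of_int b2 - real_of_int b1 * real_of_int a2)\<rfloor>)"

definition combine :: "int \<Rightarrow> int \<Rightarrow> int \<times> int \<times> int \<Rightarrow> int \<times> int \<times> int \<Rightarrow> int \<times> int \<times> int \<Rightarrow> int \<times> int \<times> int" where
  "combine \<alpha> \<beta> = (\<lambda>(a0, b0, c0) (a1, b1, c1) (a2, b2, c2).
     (a0 + \<alpha> * a1 + \<beta> * a2, b0 + \<alpha> * b1 + \<beta> * b2, c0 + \<alpha> * c1 + \<beta> * c2))"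

text \<open>
  Adding \<open>v\<^sub>k\<close> with coefficient \<open>1\<close> to an integer combination of \<open>v\<^sub>k\<^sub>+\<^sub>1\<close> and \<open>v\<^sub>k\<^sub>+\<^sub>2\<close> preserves the
  determinant.  The combination is chosen to bring the first two coordinates near the target
  \<open>(X (k+3), Y (k+3))\<close>, up to an error of the size of the previous vectors.  The term \<open>\<eta> k\<close> is the free
  choice.  Starting from a permuted standard basis, the targets are met from index \<open>3\<close> on.
\<close>

fun chain :: "(nat \<Rightarrow> real) \<Rightarrow> (nat \<Rightarrow> real) \<Rightarrow> (nat \<Rightarrow> int) \<Rightarrow> nat \<Rightarrow> int \<times> int \<times> int" where
  "chain X Y \<eta> 0 = (0, 0, 1)"
| "chain X Y \<eta> (Suc 0) = (1, 0, 0)"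
| "chain X Y \<eta> (Suc (Suc 0)) = (0, 1, 0)"
| "chain X Y \<eta> (Suc (Suc (Suc k))) =
     combine (coeff1 (X (k+3)) (Y (k+3)) (chain X Y \<eta> (Suc k)) (chain X Y \<eta> (Suc (Suc k))))
       (coeff2 (X (k+3)) (Y (k+3)) (chain X Y \<eta> (Suc k)) (chain X Y \<eta> (Suc (Suc k))) + \<eta> k)
       (chain X Y \<eta> k) (chain X Y \<eta> (Suc k)) (chain X Y \<eta> (Suc (Suc k)))"

lemma chain_cong:
  assumes "\<And>m. m < n \<Longrightarrow> \<eta> m = \<eta>' m" "k < n + 3"
  shows "chain X Y \<eta> k = chain X Y \<eta>' k"
  using assms(2)
proof (induction k rule: less_induct)
  case (less k)
  consider "k = 0" | "k = Suc 0" | "k = Suc (Suc 0)" | m where "k = Suc (Suc (Suc m))"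
    by (metis not0_implies_Suc)
  then show ?case
  proof cases
    case 4
    then show ?thesis
      using less.IH[of m] less.IH[of "Suc m"] less.IH[of "Suc (Suc m)"] assms(1)[of m] less.prems by simp
  qed auto
qed

lemma floor_combination_error:
  fixes a0 a1 a2 e :: int and s t T :: real
  assumes "s * a1 + t * a2 = T" "0 \<le> a0" "0 \<le> a1" "0 \<le> a2" "e \<in> {0, 1}"
  shows "\<bar>of_int (a0 + \<lfloor>s\<rfloor> * a1 + (\<lfloor>t\<rfloor> + e) * a2) - T\<bar> \<le> of_int (a0 + a1 + a2)"
proof -
  define u v where "u = \<lfloor>s\<rfloor> - s" and "v = \<lfloor>t\<rfloor> + e - t"
  have uv: "\<bar>u\<bar> \<le> 1" "\<bar>v\<bar> \<le> 1"
    using assms(5) unfolding u_def v_def by (auto; linarith)+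
  have a: "0 \<le> real_of_int a0" "0 \<le> real_of_int a1" "0 \<le> real_of_int a2"
    using assms by simp_all
  have "of_int (a0 + \<lfloor>s\<rfloor> * a1 + (\<lfloor>t\<rfloor> + e) * a2) - T = a0 + u * a1 + v * a2"
    unfolding assms(1)[symmetric] u_def v_def by (simp add: algebra_simps)
  moreover have "\<bar>u * a1\<bar> \<le> a1" "\<bar>v * a2\<bar> \<le> a2"
    using uv a by (simp_all add: abs_mult mult_left_le_one_le)
  ultimately show ?thesis
    using a by simp
qed

context fast_growth
begin

lemma combine_near_target:
  assumes v: "v0 = (a0, b0, c0)" "v1 = (a1, b1, c1)" "v2 = (a2, b2, c2)"
    and nonneg: "0 \<le> a0" "0 \<le> a1" "0 \<le> a2" "0 \<le> b0" "0 \<le> b1" "0 \<le> b2"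
    and D: "a1 * b2 - b1 * a2 \<noteq> 0" and e: "e \<in> {0, 1}"
    and w: "combine (coeff1 U V v1 v2) (coeff2 U V v1 v2 + e) v0 v1 v2 = (a3, b3, c3)"
  shows "\<bar>of_int a3 - U\<bar> \<le> of_int (a0 + a1 + a2) \<and> \<bar>of_int b3 - V\<bar> \<le> of_int (b0 + b1 + b2)"
proof -
  define D where "D = real_of_int a1 * real_of_int b2 - real_of_int b1 * real_of_int a2"
  define s t where "s = (U * real_of_int b2 - V * real_of_int a2) / D"
    and "t = (V * real_of_int a1 - U * real_of_int b1) / D"
  have Dnz: "D \<noteq> 0"
    using D unfolding D_def by (simp flip: of_int_mult of_int_diff)
  have "s * a1 + t * a2 = U * D / D" "s * b1 + t * b2 = V * D / D"
    unfolding s_def t_def times_divide_eq_left add_divide_distrib[symmetric]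
    by (simp_all add: D_def algebra_simps)
  then have sol: "s * a1 + t * a2 = U" "s * b1 + t * b2 = V"
    using Dnz by simp_all
  have "a3 = a0 + \<lfloor>s\<rfloor> * a1 + (\<lfloor>t\<rfloor> + e) * a2" "b3 = b0 + \<lfloor>s\<rfloor> * b1 + (\<lfloor>t\<rfloor> + e) * b2"
    using w unfolding v combine_def coeff1_def coeff2_def s_def t_def D_def by auto
  then show ?thesis
    using floor_combination_error[OF sol(1) nonneg(1-3) e] floor_combination_error[OF sol(2) nonneg(4-6) e]
    by simp
qed

lemma grows_past_sum:
  assumes "\<And>k. 1 \<le> U k" "\<And>k. 1000 * U k \<le> U (Suc k)"
    and "u0 \<le> 3/2 * U k" "u1 \<le> 3/2 * U (Suc k)" "u2 \<le> 3/2 * U (Suc (Suc k))"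
  shows "u0 + u1 + u2 \<le> U (Suc (Suc (Suc k))) / (2::real)"
  using assms(2)[of k] assms(2)[of "Suc k"] assms(2)[of "Suc (Suc k)"] assms(1)[of k] assms(3-5) by linarith

text \<open>
  The upper bounds hold from the start, so that the rounding error, a sum of three earlier
  coordinates, is always small against the target.  The remaining point is that the linear system for
  the coefficients is nonsingular: for the first two steps this comes from the initial vectors,
  afterwards from the turning of the vectors \<open>(x, y)\<close>.
\<close>

lemma chain_bounds:
  assumes \<eta>: "\<And>k. \<eta> k \<in> {0, 1}" and "chain X Y \<eta> k = (a, b, c)"
  shows "0 \<le> a \<and> 0 \<le> b \<and> a \<le> 3/2 * X k \<and> b \<le> 3/2 * Y k \<and> (3 \<le> k \<longrightarrow> X k / 2 \<le> a \<and> Y k / 2 \<le> b)"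
  using assms(2)
proof (induction k arbitrary: a b c rule: less_induct)
  case (less k)
  consider "k = 0" | "k = Suc 0" | "k = Suc (Suc 0)" | m where "k = Suc (Suc (Suc m))"
    by (metis not0_implies_Suc)
  then show ?case
  proof cases
    case 1 then show ?thesis using less.prems X_ge1[of k] Y_ge1[of k] by auto
  next
    case 2 then show ?thesis using less.prems X_ge1[of k] Y_ge1[of k] by auto
  next
    case 3 then show ?thesis using less.prems X_ge1[of k] Y_ge1[of k] by auto
  next
    case 4
    obtain a0 b0 c0 where v0: "chain X Y \<eta> m = (a0, b0, c0)" by (metis prod_cases3)
    obtain a1 b1 c1 where v1: "chain X Y \<eta> (Suc m) = (a1, b1, c1)" by (metis prod_cases3)
    obtain a2 b2 c2 where v2: "chain X Y \<eta> (Suc (Suc m)) = (a2, b2, c2)" by (metis prod_cases3)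
    note IH = less.IH[OF _ v0] less.IH[OF _ v1] less.IH[OF _ v2]
    have D: "a1 * b2 - b1 * a2 \<noteq> 0"
    proof -
      consider "m = 0" | "m = 1" | "m \<ge> 2" by linarith
      then show ?thesis
      proof cases
        case 1
        then show ?thesis using v1 v2 by auto
      next
        case 2
        then have v1': "a1 = 0" "b1 = 1" using v1 by (auto simp: numeral_2_eq_2)
        have "X (Suc (Suc m)) / 2 \<le> a2" using IH(3) 4 2 by simp
        then have "0 < real_of_int a2" using X_pos[of "Suc (Suc m)"] by linarith
        then show ?thesis using v1' by simp
      next
        case 3
        have l: "X (Suc (Suc m)) / 2 \<le> a2" "Y (Suc m) / 2 \<le> b1"
          and u: "a1 \<le> 3/2 * X (Suc m)" "b2 \<le> 3/2 * Y (Suc (Suc m))" "0 \<le> a1" "0 \<le> b2"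
          using IH(2,3) 4 3 by simp_all
        have "real_of_int a1 * b2 \<le> (3/2 * X (Suc m)) * (3/2 * Y (Suc (Suc m)))"
          using u X_pos[of "Suc m"] by (intro mult_mono) auto
        also have "\<dots> = 9/4 * (X (Suc m) * Y (Suc (Suc m)))" by simp
        also have "\<dots> < 1/4 * (X (Suc (Suc m)) * Y (Suc m))"
          using ratio_grow[of "Suc m"] mult_pos_pos[OF X_pos[of "Suc (Suc m)"] Y_pos[of "Suc m"]] by linarith
        also have "\<dots> = (X (Suc (Suc m)) / 2) * (Y (Suc m) / 2)" by simp
        also have "\<dots> \<le> real_of_int a2 * b1"
          using l X_pos[of "Suc (Suc m)"] Y_pos[of "Suc m"] by (intro mult_mono) auto
        finally have "real_of_int (a1 * b2) < real_of_int (b1 * a2)" by (simp add: mult.commute)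
        then show ?thesis by (simp only: of_int_less_iff)
      qed
    qed
    have near: "\<bar>of_int a - X k\<bar> \<le> of_int (a0 + a1 + a2) \<and> \<bar>of_int b - Y k\<bar> \<le> of_int (b0 + b1 + b2)"
    proof (rule combine_near_target[OF v0 v1 v2])
      show "combine (coeff1 (X k) (Y k) (chain X Y \<eta> (Suc m)) (chain X Y \<eta> (Suc (Suc m))))
         (coeff2 (X k) (Y k) (chain X Y \<eta> (Suc m)) (chain X Y \<eta> (Suc (Suc m))) + \<eta> m)
         (chain X Y \<eta> m) (chain X Y \<eta> (Suc m)) (chain X Y \<eta> (Suc (Suc m))) = (a, b, c)"
        using less.prems unfolding 4 by (simp add: numeral_3_eq_3)
    qed (use D \<eta> IH 4 in auto)
    have small: "real_of_int a0 \<le> 3/2 * X m" "real_of_int a1 \<le> 3/2 * X (Suc m)"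
      "real_of_int a2 \<le> 3/2 * X (Suc (Suc m))" "real_of_int b0 \<le> 3/2 * Y m"
      "real_of_int b1 \<le> 3/2 * Y (Suc m)" "real_of_int b2 \<le> 3/2 * Y (Suc (Suc m))"
      using IH 4 by simp_all
    have "real_of_int a0 + a1 + a2 \<le> X k / 2" "real_of_int b0 + b1 + b2 \<le> Y k / 2"
      unfolding 4 using grows_past_sum[OF X_ge1 X_grow small(1-3)] grows_past_sum[OF Y_ge1 Y_grow small(4-6)]
      by simp_all
    then have "\<bar>a - X k\<bar> \<le> X k / 2" "\<bar>b - Y k\<bar> \<le> Y k / 2"
      using near unfolding of_int_add by linarith+
    then have "X k / 2 \<le> a" "a \<le> 3/2 * X k" "Y k / 2 \<le> b" "b \<le> 3/2 * Y k"
      by linarith+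
    moreover then have "0 < real_of_int a" "0 < real_of_int b"
      using X_pos[of k] Y_pos[of k] by linarith+
    ultimately show ?thesis by simp
  qed
qed

lemma chain_unimodular:
  assumes "chain X Y \<eta> k = (a0, b0, c0)" "chain X Y \<eta> (Suc k) = (a1, b1, c1)"
    "chain X Y \<eta> (Suc (Suc k)) = (a2, b2, c2)"
  shows "a0 * (b1 * c2 - c1 * b2) - b0 * (a1 * c2 - c1 * a2) + c0 * (a1 * b2 - b1 * a2) = 1"
  using assms
proof (induction k arbitrary: a0 b0 c0 a1 b1 c1 a2 b2 c2)
  case 0
  then show ?case by auto
next
  case (Suc k)
  obtain a b c where v: "chain X Y \<eta> k = (a, b, c)" by (metis prod_cases3)
  obtain \<alpha> \<beta> where "a2 = a + \<alpha> * a0 + \<beta> * a1" "b2 = b + \<alpha> * b0 + \<beta> * b1" "c2 = c + \<alpha> * c0 + \<beta> * c1"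
    using Suc.prems(3) unfolding chain.simps v Suc.prems(1,2) combine_def by auto
  moreover have "a * (b0 * c1 - c0 * b1) - b * (a0 * c1 - c0 * a1) + c * (a0 * b1 - b0 * a1) = 1"
    by (rule Suc.IH[OF v Suc.prems(1,2)])
  ultimately show ?case by (simp add: algebra_simps)
qed

lemma approx_chain_exists:
  assumes \<eta>: "\<And>k. \<eta> k \<in> {0, 1}"
  shows "approx_chain (\<lambda>k. X (k+3)) (\<lambda>k. Y (k+3)) (\<lambda>k. fst (chain X Y \<eta> (k+3)))
    (\<lambda>k. fst (snd (chain X Y \<eta> (k+3)))) (\<lambda>k. snd (snd (chain X Y \<eta> (k+3))))"
proof
  fix k
  obtain a0 b0 c0 where v0: "chain X Y \<eta> (k+3) = (a0, b0, c0)" by (metis prod_cases3)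
  obtain a1 b1 c1 where v1: "chain X Y \<eta> (Suc (k+3)) = (a1, b1, c1)" by (metis prod_cases3)
  obtain a2 b2 c2 where v2: "chain X Y \<eta> (Suc (Suc (k+3))) = (a2, b2, c2)" by (metis prod_cases3)
  show "1 \<le> X (k+3)" "1 \<le> Y (k+3)" by (rule X_ge1 Y_ge1)+
  show "1000 * X (k+3) \<le> X (Suc k + 3)" "1000 * Y (k+3) \<le> Y (Suc k + 3)"
    "1000 * (X (k+3) * Y (Suc k + 3)) \<le> X (Suc k + 3) * Y (k+3)"
    using X_grow[of "k+3"] Y_grow[of "k+3"] ratio_grow[of "k+3"] by simp_all
  show "X (k+3) / 2 \<le> fst (chain X Y \<eta> (k+3))" "fst (chain X Y \<eta> (k+3)) \<le> 3/2 * X (k+3)"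
    "Y (k+3) / 2 \<le> fst (snd (chain X Y \<eta> (k+3)))" "fst (snd (chain X Y \<eta> (k+3))) \<le> 3/2 * Y (k+3)"
    using chain_bounds[OF \<eta> v0] by (simp_all add: v0)
  have k: "k + 1 + 3 = Suc (k+3)" "k + 2 + 3 = Suc (Suc (k+3))" by simp_all
  show "fst (chain X Y \<eta> (k+3)) *
        (fst (snd (chain X Y \<eta> (k+1+3))) * snd (snd (chain X Y \<eta> (k+2+3))) -
         snd (snd (chain X Y \<eta> (k+1+3))) * fst (snd (chain X Y \<eta> (k+2+3)))) -
        fst (snd (chain X Y \<eta> (k+3))) *
        (fst (chain X Y \<eta> (k+1+3)) * snd (snd (chain X Y \<eta> (k+2+3))) -
         snd (snd (chain X Y \<eta> (k+1+3))) * fst (chain X Y \<eta> (k+2+3))) +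
        snd (snd (chain X Y \<eta> (k+3))) *
        (fst (chain X Y \<eta> (k+1+3)) * fst (snd (chain X Y \<eta> (k+2+3))) -
         fst (snd (chain X Y \<eta> (k+1+3))) * fst (chain X Y \<eta> (k+2+3))) = 1"
    unfolding k v0 v1 v2 fst_conv snd_conv by (rule chain_unimodular[OF v0 v1 v2])
qed

definition chain_limit :: "(nat \<Rightarrow> int) \<Rightarrow> real \<times> real" where
  "chain_limit \<eta> =
    (approx_chain.\<theta>1 (\<lambda>k. fst (chain X Y \<eta> (k+3))) (\<lambda>k. fst (snd (chain X Y \<eta> (k+3)))) (\<lambda>k. snd (snd (chain X Y \<eta> (k+3)))),
     approx_chain.\<theta>2 (\<lambda>k. fst (chain X Y \<eta> (k+3))) (\<lambda>k. fst (snd (chain X Y \<eta> (k+3)))) (\<lambda>k. snd (snd (chain X Y \<eta> (k+3)))))"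

text \<open>
  The condition on index \<open>0\<close> makes the first difference occur in a step whose preceding vector
  already belongs to the part of the chain where the size bounds hold.
\<close>

lemma chain_limit_inj:
  assumes \<eta>: "\<And>k. \<eta> k \<in> {0, 1}" "\<And>k. \<eta>' k \<in> {0, 1}"
    and first: "\<eta> 0 = \<eta>' 0" and "\<eta> \<noteq> \<eta>'"
  shows "chain_limit \<eta> \<noteq> chain_limit \<eta>'"
proof -
  define n where "n = (LEAST n. \<eta> n \<noteq> \<eta>' n)"
  have "\<exists>n. \<eta> n \<noteq> \<eta>' n" using assms by auto
  then have n: "\<eta> n \<noteq> \<eta>' n" and before: "\<And>m. m < n \<Longrightarrow> \<eta> m = \<eta>' m"
    unfolding n_def by (rule LeastI_ex) (auto dest: not_less_Least)
  obtain p where p: "n = Suc p" using n first by (cases n) auto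
  have eq: "chain X Y \<eta> m = chain X Y \<eta>' m" if "m < p + 4" for m
    using that p by (intro chain_cong[of n]) (auto simp: before)
  obtain a0 b0 c0 where v0: "chain X Y \<eta>' (Suc p) = (a0, b0, c0)" by (metis prod_cases3)
  obtain a1 b1 c1 where v1: "chain X Y \<eta>' (Suc (Suc p)) = (a1, b1, c1)" by (metis prod_cases3)
  obtain a2 b2 c2 where v2: "chain X Y \<eta>' (Suc (Suc (Suc p))) = (a2, b2, c2)" by (metis prod_cases3)
  have v: "chain X Y \<eta> (Suc p) = (a0, b0, c0)" "chain X Y \<eta> (Suc (Suc p)) = (a1, b1, c1)"
    "chain X Y \<eta> (Suc (Suc (Suc p))) = (a2, b2, c2)"
    using eq[of "Suc p"] eq[of "Suc (Suc p)"] eq[of "Suc (Suc (Suc p))"] v0 v1 v2 by simp_all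
  have i: "p + 3 = Suc (Suc (Suc p))" "Suc p + 3 = Suc (Suc (Suc (Suc p)))" by simp_all
  show ?thesis
    unfolding chain_limit_def
  proof (rule chains_separate[where k = p, OF approx_chain_exists[OF \<eta>(1)] approx_chain_exists[OF \<eta>(2)]])
    show "\<eta>' n - \<eta> n \<noteq> 0" using n by simp
  qed (simp_all only: i chain.simps(4)[of _ _ _ "Suc p"] v v0 v1 v2 p combine_def,
      simp_all add: algebra_simps)
qed

end



section \<open>The exponents of the limit point\<close>

lemma Sup_ereal_eqI:
  fixes w :: real
  assumes "0 < w" and below: "\<And>\<nu>. 0 < \<nu> \<Longrightarrow> \<nu> < w \<Longrightarrow> P \<nu>" and above: "\<And>\<nu>. w < \<nu> \<Longrightarrow> \<not> P \<nu>"
  shows "Sup (ereal ` {\<nu>. P \<nu>}) = ereal w"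
proof (rule antisym)
  show "Sup (ereal ` {\<nu>. P \<nu>}) \<le> ereal w"
    using above by (intro Sup_least) (auto simp: not_less[symmetric])
  show "ereal w \<le> Sup (ereal ` {\<nu>. P \<nu>})"
  proof (rule ccontr)
    assume "\<not> ereal w \<le> Sup (ereal ` {\<nu>. P \<nu>})"
    then obtain r where r: "Sup (ereal ` {\<nu>. P \<nu>}) < ereal r" "ereal r < ereal w"
      using ereal_dense2[of "Sup (ereal ` {\<nu>. P \<nu>})" "ereal w"] by (auto simp: not_le)
    have "P (max r (w / 2))"
      using assms(1) r(2) by (intro below) auto
    then have "ereal (max r (w / 2)) \<le> Sup (ereal ` {\<nu>. P \<nu>})"
      by (intro Sup_upper imageI CollectI)
    also have "\<dots> < ereal r" by (rule r)
    finally show False by simp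
  qed
qed

text \<open>
  This reduces the uniform statement for all large \<open>T\<close> to the consecutive intervals between the
  members of an unbounded sequence.
\<close>

lemma eventually_between:
  fixes f :: "nat \<Rightarrow> real"
  assumes lim: "filterlim f at_top sequentially" and P: "\<forall>\<^sub>F k in sequentially. P k"
  shows "\<forall>\<^sub>F T in at_top. \<exists>k. P k \<and> f k \<le> T \<and> T < f (Suc k)"
proof -
  obtain K where K: "\<And>k. K \<le> k \<Longrightarrow> P k"
    using P by (auto simp: eventually_sequentially)
  have "\<exists>k. P k \<and> f k \<le> T \<and> T < f (Suc k)" if T: "f K \<le> T" for T
  proof -
    have "\<forall>\<^sub>F n in sequentially. T < f n"
      using lim by (simp add: filterlim_at_top_dense)
    then obtain M where M: "\<And>n. M \<le> n \<Longrightarrow> T < f n"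
      unfolding eventually_sequentially by blast
    define n where "n = (LEAST n. K \<le> n \<and> T < f n)"
    have n: "K \<le> n \<and> T < f n"
      unfolding n_def using LeastI[of "\<lambda>n. K \<le> n \<and> T < f n" "max M K"] M[of "max M K"] by simp
    then obtain m where m: "n = Suc m" "K \<le> m"
      using T by (cases n) (auto simp: le_Suc_eq)
    have "f m \<le> T"
      using not_less_Least[of m "\<lambda>n. K \<le> n \<and> T < f n"] m unfolding n_def[symmetric] by (simp add: not_less)
    then show ?thesis using n m K by blast
  qed
  then show ?thesis
    by (auto simp: eventually_at_top_linorder intro!: exI[of _ "f K"])
qed

text \<open>
  Here \<open>a\<close> and \<open>b\<close> are the weights \<open>2i\<close> and \<open>2j\<close>, while \<open>s < b\<close> is the exponent that the second
  coordinates really have.  The last two assumptions say that at \<open>H\<^sub>k\<^sub>+\<^sub>1 powr w\<close> the first error of the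
  dual vector has exactly the size belonging to the exponent \<open>l\<close>, and that the second error is not
  the obstruction.
\<close>

locale power_chain = approx_chain "\<lambda>k. H k powr a" "\<lambda>k. H k powr s" x y z
  for H :: "nat \<Rightarrow> real" and a s :: real and x y z +
  fixes b w g l :: real
  assumes H_gt1: "1 < H k" and H_Suc: "H (Suc k) = H k powr g"
    and H_lim: "filterlim H at_top sequentially"
    and a_gt1: "1 < a" and b_pos: "0 < b" and ab: "a + b = 2" and s_pos: "0 < s" and s_less: "s < b"
    and g_gt2: "2 < g" and w_eq: "w = s + a * g" and l_eq: "a * l * w = w - s" and l_less: "b * l * w < w - a"
begin

lemma w_gt: "2 * a < w"
proof -
  have "a * 2 < a * g" using a_gt1 g_gt2 by simp
  then show ?thesis using w_eq s_pos by simp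
qed

lemma w_pos: "0 < w" and l_pos: "0 < l"
proof -
  show w: "0 < w" using w_gt a_gt1 by simp
  have "(a * w) * l = w - s" using l_eq by (simp only: mult_ac)
  then have "0 < (a * w) * l" using w_gt s_less ab a_gt1 by linarith
  then show "0 < l" using w a_gt1 zero_less_mult_pos[of "a * w" l] by simp
qed

lemma H_pos: "0 < H k" using H_gt1[of k] by linarith

lemma H_mono: "H k \<le> H (Suc k)"
  using powr_mono[of 1 g "H k"] H_gt1[of k] g_gt2 unfolding H_Suc by simp

lemma H_powr_lim: "filterlim (\<lambda>k. H k powr w) at_top sequentially"
proof (rule filterlim_at_top_mono[OF H_lim], rule always_eventually, rule allI)
  show "H k \<le> H k powr w" for k
    using powr_mono[of 1 w "H k"] H_gt1[of k] w_gt a_gt1 by simp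
qed

lemma W_eq: "W k = H k powr w"
  unfolding W_def w_eq using H_Suc[of k] by (simp add: powr_powr powr_add mult.commute)

lemma eventually_small:
  assumes "e < 0" "0 < \<epsilon>"
  shows "\<forall>\<^sub>F k in sequentially. C * H (Suc k) powr e < \<epsilon>"
proof -
  have "filterlim (\<lambda>k. H (Suc k)) at_top sequentially"
    using H_lim by (rule filterlim_compose) (rule filterlim_Suc)
  with assms(1) have "(\<lambda>k. H (Suc k) powr e) \<longlonglongrightarrow> 0"
    by (rule tendsto_neg_powr)
  then have "(\<lambda>k. C * H (Suc k) powr e) \<longlonglongrightarrow> 0"
    by (rule tendsto_mult_right_zero)
  from order_tendstoD(2)[OF this assms(2)] show ?thesis .
qed

lemma H_Suc_powr_le: "0 \<le> e \<Longrightarrow> H k powr e \<le> H (Suc k) powr e"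
  using H_mono[of k] H_pos[of k] by (intro powr_mono2) auto

lemma x_le: "x k \<le> 3/2 * H (Suc k) powr a" and y_le: "y k \<le> 3/2 * H (Suc k) powr s"
  using x_upper[of k] y_upper[of k] H_Suc_powr_le[of a k] H_Suc_powr_le[of s k] a_gt1 s_pos by linarith+

lemma error_bounds:
  shows "\<bar>N k * \<theta>1 - R k\<bar> \<le> 64 * H (Suc k) powr (s - w)"
    and "H (Suc k) powr (s - w) / 64 \<le> \<bar>N k * \<theta>1 - R k\<bar>"
    and "\<bar>N k * \<theta>2 - S k\<bar> \<le> 64 * H (Suc k) powr (a - w)"
  using first_error_upper[of k] first_error_lower[of k] second_error_upper[of k]
  by (simp_all add: W_eq powr_diff mult.commute)

lemma L_bounds:
  shows "\<bar>L k\<bar> \<le> 16 * H (Suc k) powr (- w)" and "H (Suc k) powr (- w) / 16 \<le> \<bar>L k\<bar>"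
  using L_upper[of k] L_lower[of k] by (simp_all add: W_eq powr_minus_divide mult.commute)

text \<open>
  An integer relation would pair with all late dual vectors to integers tending to \<open>0\<close>, hence to
  \<open>0\<close>.  Orthogonality to two consecutive ones makes it a multiple of the vector they have in common,
  whose linear form does not vanish at the limit point.
\<close>

lemma integer_independent:
  fixes p r q :: int
  assumes "q - p * \<theta>1 - r * \<theta>2 = 0"
  shows "p = 0 \<and> r = 0 \<and> q = 0"
proof -
  have "\<forall>\<^sub>F k in sequentially. (64 * \<bar>p\<bar>) * H (Suc k) powr (s - w) < 1/2"
    "\<forall>\<^sub>F k in sequentially. (64 * \<bar>r\<bar>) * H (Suc k) powr (a - w) < 1/2"
    using w_gt a_gt1 s_less ab by (intro eventually_small; simp)+
  then have "\<forall>\<^sub>F k in sequentially. N k * q - R k * p - S k * r = 0"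
  proof eventually_elim
    case (elim k)
    have "\<bar>p * (N k * \<theta>1 - R k)\<bar> \<le> \<bar>p\<bar> * (64 * H (Suc k) powr (s - w))"
      "\<bar>r * (N k * \<theta>2 - S k)\<bar> \<le> \<bar>r\<bar> * (64 * H (Suc k) powr (a - w))"
      unfolding abs_mult of_int_abs using error_bounds[of k] by (intro mult_left_mono; simp)+
    then have "\<bar>real_of_int (N k * q - R k * p - S k * r)\<bar> < 1"
      unfolding pairing_eq assms using elim by (simp add: mult_ac)
    then show ?case by linarith
  qed
  then obtain k where "\<forall>m\<ge>k. N m * q - R m * p - S m * r = 0"
    unfolding eventually_sequentially by blast
  then have k: "N k * q - R k * p - S k * r = 0" "N (k+1) * q - R (k+1) * p - S (k+1) * r = 0"
    by (blast, metis le_add1)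
  obtain d where d: "p = d * x (k+1)" "r = d * y (k+1)" "q = d * z (k+1)"
    using vector_in_basis[OF k(1)] k(2) by (metis add_0 minus_zero mult_zero_left)
  have "d * L (k+1) = 0"
    using assms unfolding d L_def by (simp add: algebra_simps)
  then show ?thesis using L_nz d by simp
qed

lemma independent: "indep_over_rat (\<theta>1, \<theta>2)"
  unfolding indep_over_rat_iff
proof (intro allI impI)
  fix A B C :: rat
  assume eq: "of_rat A + of_rat B * \<theta>1 + of_rat C * \<theta>2 = (0 :: real)"
  have frac: "\<exists>m n :: int. n \<noteq> 0 \<and> c = of_int m / of_int n" for c :: rat
    by (metis Fract_of_int_quotient Rat_cases less_irrefl)
  obtain m1 n1 m2 n2 m3 n3 :: int where
    q: "n1 \<noteq> 0" "A = of_int m1 / of_int n1" "n2 \<noteq> 0" "B = of_int m2 / of_int n2"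
       "n3 \<noteq> 0" "C = of_int m3 / of_int n3"
    using frac[of A] frac[of B] frac[of C] by blast
  have "real_of_int (m1 * n2 * n3) - real_of_int (- m2 * n1 * n3) * \<theta>1 - real_of_int (- m3 * n1 * n2) * \<theta>2 =
     n1 * n2 * n3 * (of_rat A + of_rat B * \<theta>1 + of_rat C * \<theta>2)"
    unfolding q(2,4,6) of_rat_divide of_rat_of_int_eq using q(1,3,5) by (simp add: field_simps)
  also have "\<dots> = 0" using eq by simp
  finally have "- m2 * n1 * n3 = 0 \<and> - m3 * n1 * n2 = 0 \<and> m1 * n2 * n3 = 0"
    by (rule integer_independent)
  then show "A = 0 \<and> B = 0 \<and> C = 0" using q by simp
qed

text \<open>
  The vector \<open>v\<^sub>k\<close> is used on the whole interval from \<open>C * H k\<close> to \<open>C * H (Suc k)\<close>, where \<open>C\<close> only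
  absorbs the constants in the size bounds for its coordinates.
\<close>

lemma omega_attained:
  assumes "0 < \<nu>" "\<nu> < w"
  shows "\<forall>\<^sub>F T in at_top. \<exists>p r q :: int. (p, r) \<noteq> (0, 0) \<and> 0 < \<bar>of_int q - of_int p * \<theta>1 - of_int r * \<theta>2\<bar> \<and>
       \<bar>of_int q - of_int p * \<theta>1 - of_int r * \<theta>2\<bar> \<le> T powr (- \<nu>) \<and> \<bar>of_int p\<bar> \<le> T powr a \<and> \<bar>of_int r\<bar> \<le> T powr b"
proof -
  define C :: real where "C = 2 powr (1 / b)"
  have C: "0 < C" "1 \<le> C" "C powr b = 2" "2 \<le> C powr a"
  proof -
    show "0 < C" "1 \<le> C" "C powr b = 2"
      unfolding C_def using b_pos by (simp_all add: powr_powr ge_one_powr_ge_zero)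
    then show "2 \<le> C powr a"
      using powr_mono[of b a C] a_gt1 ab by simp
  qed
  have "filterlim (\<lambda>k. C * H k) at_top sequentially"
    using C H_lim by (intro filterlim_tendsto_pos_mult_at_top[OF tendsto_const])
  moreover have "\<forall>\<^sub>F k in sequentially. (16 * C powr \<nu>) * H (Suc k) powr (\<nu> - w) < 1"
    using assms by (intro eventually_small) auto
  ultimately have "\<forall>\<^sub>F T in at_top. \<exists>k. (16 * C powr \<nu>) * H (Suc k) powr (\<nu> - w) < 1 \<and>
      C * H k \<le> T \<and> T < C * H (Suc k)"
    by (rule eventually_between)
  then show ?thesis
  proof eventually_elim
    case (elim T)
    then obtain k where k: "(16 * C powr \<nu>) * H (Suc k) powr (\<nu> - w) < 1" "C * H k \<le> T" "T < C * H (Suc k)"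
      by blast
    have CH: "0 < C * H k" using C H_pos by simp
    then have T: "0 < T" using k by linarith
    have "16 * H (Suc k) powr (- w) = (16 * C powr \<nu> * H (Suc k) powr (\<nu> - w)) * (C * H (Suc k)) powr (- \<nu>)"
      using C H_pos[of "Suc k"] by (simp add: powr_mult powr_diff powr_minus field_simps)
    also have "\<dots> \<le> 1 * (C * H (Suc k)) powr (- \<nu>)"
      using k(1) by (intro mult_right_mono) auto
    also have "\<dots> \<le> T powr (- \<nu>)"
      using powr_mono2'[of "- \<nu>" T "C * H (Suc k)"] assms T k(3) by simp
    finally have Lk: "\<bar>L k\<bar> \<le> T powr (- \<nu>)"
      using L_bounds[of k] by linarith
    have "x k \<le> 2 * H k powr a" using x_upper[of k] powr_ge_zero[of "H k" a] by linarith
    also have "\<dots> \<le> C powr a * H k powr a" using C by (intro mult_right_mono) auto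
    also have "\<dots> = (C * H k) powr a" using C H_pos[of k] by (simp add: powr_mult)
    also have "\<dots> \<le> T powr a" using CH k(2) a_gt1 by (intro powr_mono2) auto
    finally have xk: "x k \<le> T powr a" .
    have "y k \<le> 2 * H k powr s" using y_upper[of k] powr_ge_zero[of "H k" s] by linarith
    also have "\<dots> \<le> C powr b * H k powr b"
      using C H_gt1[of k] s_less by (intro mult_mono powr_mono) auto
    also have "\<dots> = (C * H k) powr b" using C H_pos[of k] by (simp add: powr_mult)
    also have "\<dots> \<le> T powr b" using CH k(2) b_pos by (intro powr_mono2) auto
    finally have yk: "y k \<le> T powr b" .
    show ?case
      using Lk xk yk x_pos[of k] y_pos[of k] L_nz[of k] unfolding L_def
      by (intro exI[of _ "x k"] exI[of _ "y k"] exI[of _ "z k"]) auto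
  qed
qed

lemma pairing_vanishes:
  fixes p r q :: int and h V :: real
  assumes h: "h = H (Suc k)" and "\<bar>real_of_int p\<bar> \<le> h powr a" "\<bar>real_of_int r\<bar> \<le> h powr b" "\<bar>q - p * \<theta>1 - r * \<theta>2\<bar> \<le> V"
    and "8 * h powr w * V < 1/4" "64 * h powr (a + s - w) < 1/4" "64 * h powr (a + b - w) < 1/4"
  shows "N k * q - R k * p - S k * r = 0"
proof -
  have N: "0 < real_of_int (N k)" "real_of_int (N k) \<le> 8 * h powr w"
    using N_pos[of k] N_upper[of k] H_Suc_powr_le[of w k] w_pos by (auto simp: W_eq h)
  have "\<bar>N k * (q - p * \<theta>1 - r * \<theta>2)\<bar> \<le> (8 * h powr w) * V"
    unfolding abs_mult using N assms(4) by (intro mult_mono) auto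
  moreover have "\<bar>p * (N k * \<theta>1 - R k)\<bar> \<le> h powr a * (64 * h powr (s - w))"
    unfolding abs_mult using assms(2) error_bounds(1)[of k] by (intro mult_mono) (auto simp: h)
  moreover have "\<bar>r * (N k * \<theta>2 - S k)\<bar> \<le> h powr b * (64 * h powr (a - w))"
    unfolding abs_mult using assms(3) error_bounds(3)[of k] by (intro mult_mono) (auto simp: h)
  moreover have "h powr a * (64 * h powr (s - w)) = 64 * h powr (a + s - w)"
    "h powr b * (64 * h powr (a - w)) = 64 * h powr (a + b - w)"
    by (simp_all add: powr_add powr_diff)
  ultimately have "\<bar>real_of_int (N k * q - R k * p - S k * r)\<bar> < 1"
    unfolding pairing_eq using assms(5-7) by linarith
  then show ?thesis by linarith
qed

text \<open>
  Tested at \<open>T = H (Suc k) / 4\<close>.  A solution is \<open>c * v\<^sub>k + d * v\<^sub>k\<^sub>+\<^sub>1\<close> by \<open>pairing_vanishes\<close>.  If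
  \<open>d = 0\<close>, its linear form is at least that of \<open>v\<^sub>k\<close>.  If \<open>c = 0\<close>, its first coordinate is at least that
  of \<open>v\<^sub>k\<^sub>+\<^sub>1\<close>, which is too large.  Otherwise the two linear forms must cancel, which forces \<open>d\<close> to be as
  large as \<open>L\<^sub>k / L\<^sub>k\<^sub>+\<^sub>1\<close>, whereas Cramer's rule bounds \<open>d\<close> by the sizes of the coordinates.
\<close>

lemma omega_not_exceeded:
  assumes "w < \<nu>"
  shows "\<not> (\<forall>\<^sub>F T in at_top. \<exists>p r q :: int. (p, r) \<noteq> (0, 0) \<and> 0 < \<bar>of_int q - of_int p * \<theta>1 - of_int r * \<theta>2\<bar> \<and>
       \<bar>of_int q - of_int p * \<theta>1 - of_int r * \<theta>2\<bar> \<le> T powr (- \<nu>) \<and> \<bar>of_int p\<bar> \<le> T powr a \<and> \<bar>of_int r\<bar> \<le> T powr b)"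
    (is "\<not> eventually ?P at_top")
proof
  assume P: "eventually ?P at_top"
  have "filterlim (\<lambda>k. (1/4) * H (Suc k)) at_top sequentially"
    using filterlim_compose[OF H_lim filterlim_Suc]
    by (intro filterlim_tendsto_pos_mult_at_top[OF tendsto_const]) auto
  then have "\<forall>\<^sub>F k in sequentially. ?P ((1/4) * H (Suc k))"
    by (rule eventually_compose_filterlim[OF P])
  moreover have "\<forall>\<^sub>F k in sequentially. (32 * 4 powr \<nu>) * H (Suc k) powr (w - \<nu>) < 1"
    "\<forall>\<^sub>F k in sequentially. 64 * H (Suc k) powr (a + s - w) < 1/4"
    "\<forall>\<^sub>F k in sequentially. 64 * H (Suc k) powr (a + b - w) < 1/4"
    "\<forall>\<^sub>F k in sequentially. 2000 * H (Suc k) powr (2 * a - w) < 1"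
    using assms w_gt a_gt1 ab s_less by (intro eventually_small; simp)+
  ultimately have "\<forall>\<^sub>F k in sequentially. False"
  proof eventually_elim
    case (elim k)
    define h where "h = H (Suc k)"
    have h: "0 < h" "1 < h" using H_gt1[of "Suc k"] by (auto simp: h_def)
    obtain p r q :: int where pr: "(p, r) \<noteq> (0, 0)"
      and Lv: "\<bar>q - p * \<theta>1 - r * \<theta>2\<bar> \<le> (1/4 * h) powr (- \<nu>)"
      and p: "\<bar>real_of_int p\<bar> \<le> (1/4 * h) powr a" and r: "\<bar>real_of_int r\<bar> \<le> (1/4 * h) powr b"
      using elim(1) unfolding h_def by blast
    define V where "V = 4 powr \<nu> * h powr (- \<nu>)"
    have V: "(1/4 * h) powr (- \<nu>) = V"
      unfolding V_def using h by (simp add: powr_divide powr_minus field_simps)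
    have "(1/4 * h) powr a \<le> h powr a / 4"
    proof -
      have "(4::real) powr 1 \<le> 4 powr a" using a_gt1 by (intro powr_mono) auto
      then have "h powr a / 4 powr a \<le> h powr a / 4" by (intro divide_left_mono) auto
      then show ?thesis using h by (simp add: powr_divide)
    qed
    then have p': "\<bar>real_of_int p\<bar> \<le> h powr a / 4" using p by linarith
    have "(1/4 * h) powr b \<le> h powr b" using h b_pos by (intro powr_mono2) auto
    then have r': "\<bar>real_of_int r\<bar> \<le> h powr b" using r by linarith
    have Lv': "\<bar>q - p * \<theta>1 - r * \<theta>2\<bar> \<le> V" using Lv unfolding V .
    have VL: "32 * h powr w * V < 1"
      using elim(2) unfolding V_def h_def[symmetric] by (simp add: powr_diff powr_minus field_simps)
    have V_half: "V < \<bar>L k\<bar> / 2"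
    proof -
      have "V < h powr (- w) / 32" using VL h by (simp add: powr_minus field_simps)
      then show ?thesis using L_bounds(2)[of k] by (simp add: h_def)
    qed
    have "N k * q - R k * p - S k * r = 0"
    proof (rule pairing_vanishes[OF h_def _ r' Lv'])
      show "\<bar>real_of_int p\<bar> \<le> h powr a" using p' powr_ge_zero[of h a] by linarith
      show "8 * h powr w * V < 1/4" using VL by simp
    qed (use elim(3,4) in \<open>simp_all add: h_def\<close>)
    then obtain c d where cd: "p = c * x k + d * x (k+1)" "r = c * y k + d * y (k+1)" "q = c * z k + d * z (k+1)"
      by (rule vector_in_basis)
    have L_cd: "q - p * \<theta>1 - r * \<theta>2 = c * L k + d * L (k+1)"
      unfolding cd L_def by (simp add: algebra_simps)
    show False
    proof (cases "d = 0")
      case True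
      then have "1 \<le> real_of_int \<bar>c\<bar>" using pr cd by auto
      then have "1 * \<bar>L k\<bar> \<le> \<bar>c\<bar> * \<bar>L k\<bar>" by (intro mult_right_mono) auto
      then show False using Lv' V_half True unfolding L_cd by (simp add: abs_mult)
    next
      case False
      then have d: "1 \<le> real_of_int \<bar>d\<bar>" by auto
      show False
      proof (cases "c = 0")
        case True
        have "1 * real_of_int (x (k+1)) \<le> real_of_int \<bar>d\<bar> * real_of_int (x (k+1))"
          using d x_pos[of "k+1"] by (intro mult_right_mono) auto
        also have "\<dots> = \<bar>real_of_int p\<bar>"
          using x_pos[of "k+1"] True unfolding cd by (simp add: abs_mult)
        finally have "h powr a / 2 \<le> \<bar>real_of_int p\<bar>"
          using x_lower[of "k+1"] by (simp add: h_def)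
        moreover have "0 < h powr a" using h by simp
        ultimately show False using p' by linarith
      next
        case False
        then have "1 \<le> real_of_int \<bar>c\<bar>" by auto
        then have "1 * \<bar>L k\<bar> \<le> \<bar>c\<bar> * \<bar>L k\<bar>" by (intro mult_right_mono) auto
        then have "\<bar>L k\<bar> / 2 \<le> \<bar>d * L (k+1)\<bar>"
          using Lv' V_half unfolding L_cd by (simp add: abs_mult[symmetric])
        then have "h powr (- w) / 32 \<le> \<bar>d * L (k+1)\<bar>"
          using L_bounds(2)[of k] by (simp add: h_def)
        also have "\<dots> \<le> \<bar>d\<bar> * (16 * h powr (- (2 * w)))"
        proof -
          have "\<bar>L (k+1)\<bar> \<le> 16 * H (Suc (Suc k)) powr (- w)" using L_bounds(1)[of "k+1"] by simp
          also have "H (Suc (Suc k)) powr (- w) = h powr (- (g * w))"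
            unfolding H_Suc[of "Suc k"] h_def by (simp add: powr_powr)
          also have "\<dots> \<le> h powr (- (2 * w))"
            using g_gt2 w_pos h by (intro powr_mono) auto
          finally show ?thesis unfolding abs_mult of_int_abs by (intro mult_left_mono) auto
        qed
        finally have "h powr (- w) / 32 \<le> \<bar>d\<bar> * (16 * h powr (- (2 * w)))" .
        \<comment> \<open>multiply by \<open>32 * h powr (2 * w)\<close> to isolate \<open>d\<close>\<close>
        then have "h powr (- w) / 32 * (32 * h powr (2 * w)) \<le> \<bar>d\<bar> * (16 * h powr (- (2 * w))) * (32 * h powr (2 * w))"
          by (intro mult_right_mono) auto
        also have "h powr (- w) / 32 * (32 * h powr (2 * w)) = h powr w"
          using h by (simp add: powr_add[symmetric])
        also have "\<bar>d\<bar> * (16 * h powr (- (2 * w))) * (32 * h powr (2 * w)) = 512 * real_of_int \<bar>d\<bar>"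
          using h by (simp add: powr_add[symmetric])
        finally have "h powr w \<le> 512 * real_of_int \<bar>d\<bar>" .
        also have "real_of_int \<bar>d\<bar> \<le> \<bar>d\<bar> * real_of_int (N k)"
        proof -
          have "1 \<le> real_of_int (N k)" using N_pos[of k] by linarith
          then show ?thesis using d mult_left_mono[of 1 "real_of_int (N k)" "\<bar>d\<bar>"] by simp
        qed
        also have "\<bar>d\<bar> * real_of_int (N k) = \<bar>p * y k - r * x k\<bar>"
        proof -
          have "p * y k - r * x k = d * N k" unfolding cd N_def by (simp add: algebra_simps)
          then have "\<bar>p * y k - r * x k\<bar> = \<bar>d\<bar> * N k" using N_pos[of k] by (simp add: abs_mult)
          then show ?thesis by simp
        qed
        also have "\<dots> \<le> \<bar>p\<bar> * y k + \<bar>r\<bar> * x k"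
          using x_pos[of k] y_pos[of k] abs_triangle_ineq4[of "real_of_int p * y k" "real_of_int r * x k"]
          by (simp add: abs_mult)
        also have "\<dots> \<le> h powr a * (3/2 * h powr a) + h powr a * (3/2 * h powr a)"
        proof -
          have "h powr s \<le> h powr a" "h powr b \<le> h powr a"
            using h s_less ab a_gt1 by (auto intro!: powr_mono)
          then have "real_of_int \<bar>p\<bar> * real_of_int (y k) + real_of_int \<bar>r\<bar> * real_of_int (x k) \<le>
              h powr a * (3/2 * h powr a) + h powr a * (3/2 * h powr a)"
            using p' r' x_le[of k] y_le[of k] x_pos[of k] y_pos[of k] powr_ge_zero[of h a]
            unfolding h_def[symmetric] by (intro add_mono mult_mono) auto
          then show ?thesis by simp
        qed
        also have "\<dots> = 3 * (h powr a * h powr a)" by simp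
        also have "h powr a * h powr a = h powr (2 * a)" by (simp flip: powr_add)
        finally have "h powr w \<le> 1536 * h powr (2 * a)" by simp
        moreover have "2000 * h powr (2 * a) < h powr w"
          using elim(5) h unfolding h_def[symmetric] by (simp add: powr_diff field_simps)
        moreover have "0 < h powr (2 * a)" using h by simp
        ultimately show False by linarith
      qed
    qed
  qed
  then show False by simp
qed

lemma omega_hat_eq: "omega_hat (a / 2) (b / 2) (\<theta>1, \<theta>2) = ereal w"
  unfolding omega_hat_def
  using omega_attained omega_not_exceeded by (intro Sup_ereal_eqI w_pos) simp_all

text \<open>
  Both errors of the dual vector are compared with the end \<open>8 * W (k+1)\<close> of its interval of use.
\<close>

lemma lambda_attained:
  assumes "0 < \<nu>" "\<nu> < l"
  shows "\<forall>\<^sub>F T in at_top. \<exists>p r n :: int. 0 < \<bar>n\<bar> \<and> \<bar>of_int n\<bar> \<le> T \<and>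
       \<bar>of_int n * \<theta>1 - of_int p\<bar> \<le> T powr (- (a * \<nu>)) \<and> \<bar>of_int n * \<theta>2 - of_int r\<bar> \<le> T powr (- (b * \<nu>))"
proof -
  have la: "a * \<nu> * w < w - s" and lb: "b * \<nu> * w < w - a"
  proof -
    have "a * \<nu> * w < a * l * w" "b * \<nu> * w < b * l * w"
      using assms a_gt1 b_pos w_pos by simp_all
    then show "a * \<nu> * w < w - s" "b * \<nu> * w < w - a"
      using l_eq l_less by linarith+
  qed
  have "filterlim (\<lambda>k. 8 * H k powr w) at_top sequentially"
    using H_powr_lim
    by (intro filterlim_tendsto_pos_mult_at_top[OF tendsto_const]) auto
  moreover have "\<forall>\<^sub>F k in sequentially. (64 * 8 powr (a * \<nu>)) * H (Suc k) powr (s - w + a * \<nu> * w) < 1 \<and>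
      (64 * 8 powr (b * \<nu>)) * H (Suc k) powr (a - w + b * \<nu> * w) < 1"
    using la lb by (intro eventually_conj eventually_small) auto
  ultimately have "\<forall>\<^sub>F T in at_top. \<exists>k. ((64 * 8 powr (a * \<nu>)) * H (Suc k) powr (s - w + a * \<nu> * w) < 1 \<and>
      (64 * 8 powr (b * \<nu>)) * H (Suc k) powr (a - w + b * \<nu> * w) < 1) \<and>
      8 * H k powr w \<le> T \<and> T < 8 * H (Suc k) powr w"
    by (rule eventually_between)
  then show ?thesis
  proof eventually_elim
    case (elim T)
    then obtain k where k: "(64 * 8 powr (a * \<nu>)) * H (Suc k) powr (s - w + a * \<nu> * w) < 1"
      "(64 * 8 powr (b * \<nu>)) * H (Suc k) powr (a - w + b * \<nu> * w) < 1"
      "8 * H k powr w \<le> T" "T < 8 * H (Suc k) powr w"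
      by blast
    have T: "0 < T" using k(3) H_pos[of k] by (smt (verit) powr_gt_zero)
    have err: "64 * H (Suc k) powr (c - w) \<le> T powr (- (e * \<nu>))"
      if "64 * 8 powr (e * \<nu>) * H (Suc k) powr (c - w + e * \<nu> * w) < 1" "0 < e" for c e
    proof -
      have "64 * H (Suc k) powr (c - w) =
          (64 * 8 powr (e * \<nu>) * H (Suc k) powr (c - w + e * \<nu> * w)) * (8 * H (Suc k) powr w) powr (- (e * \<nu>))"
        using H_pos[of "Suc k"]
        by (simp add: powr_mult powr_powr powr_minus powr_add powr_diff field_simps)
      also have "\<dots> \<le> 1 * (8 * H (Suc k) powr w) powr (- (e * \<nu>))"
        using that by (intro mult_right_mono) auto
      also have "\<dots> \<le> T powr (- (e * \<nu>))"
        using powr_mono2'[of "- (e * \<nu>)" T "8 * H (Suc k) powr w"] that assms T k(4) by simp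
      finally show ?thesis .
    qed
    have "\<bar>N k * \<theta>1 - R k\<bar> \<le> T powr (- (a * \<nu>))" "\<bar>N k * \<theta>2 - S k\<bar> \<le> T powr (- (b * \<nu>))"
      using err[OF k(1)] err[OF k(2)] error_bounds[of k] a_gt1 b_pos by linarith+
    moreover have "real_of_int (N k) \<le> T" using N_upper[of k] k(3) by (simp add: W_eq)
    ultimately show ?case
      using N_pos[of k] by (intro exI[of _ "R k"] exI[of _ "S k"] exI[of _ "N k"]) auto
  qed
qed

text \<open>
  Tested at \<open>T = H (Suc k) powr w / 64\<close>, just below the next dual vector.  A solution is orthogonal to
  \<open>v\<^sub>k\<close> and \<open>v\<^sub>k\<^sub>+\<^sub>1\<close>, hence a multiple of \<open>(N k, R k, S k)\<close>, and its first error is at least the first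
  error of that vector.
\<close>

lemma lambda_not_exceeded:
  assumes "l < \<nu>"
  shows "\<not> (\<forall>\<^sub>F T in at_top. \<exists>p r n :: int. 0 < \<bar>n\<bar> \<and> \<bar>of_int n\<bar> \<le> T \<and>
       \<bar>of_int n * \<theta>1 - of_int p\<bar> \<le> T powr (- (a * \<nu>)) \<and> \<bar>of_int n * \<theta>2 - of_int r\<bar> \<le> T powr (- (b * \<nu>)))"
    (is "\<not> eventually ?P at_top")
proof
  assume P: "eventually ?P at_top"
  have la: "w - s < a * \<nu> * w"
    using l_eq mult_strict_left_mono[of l \<nu> "a * w"] assms a_gt1 w_pos by (auto simp: mult_ac)
  have a_exp: "a < a * \<nu> * w"
    using la w_gt s_less ab a_gt1 by linarith
  have b_exp: "s < b * \<nu> * w"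
  proof -
    have "a < a * (\<nu> * w)" using a_exp by (simp add: mult_ac)
    then have "1 < \<nu> * w" using a_gt1 by (simp add: mult_less_cancel_left1)
    then have "b < b * (\<nu> * w)" using b_pos by (simp add: mult_less_cancel_left1)
    then show ?thesis using s_less by (simp add: mult_ac)
  qed
  have "filterlim (\<lambda>k. (1/64) * H (Suc k) powr w) at_top sequentially"
    using filterlim_compose[OF H_powr_lim filterlim_Suc]
    by (intro filterlim_tendsto_pos_mult_at_top[OF tendsto_const]) auto
  then have "\<forall>\<^sub>F k in sequentially. ?P ((1/64) * H (Suc k) powr w)"
    by (rule eventually_compose_filterlim[OF P])
  moreover have "\<forall>\<^sub>F k in sequentially. (3/2 * 64 powr (a * \<nu>)) * H (Suc k) powr (a - a * \<nu> * w) < 1/4"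
    "\<forall>\<^sub>F k in sequentially. (3/2 * 64 powr (b * \<nu>)) * H (Suc k) powr (s - b * \<nu> * w) < 1/4"
    "\<forall>\<^sub>F k in sequentially. (64 * 64 powr (a * \<nu>)) * H (Suc k) powr (w - s - a * \<nu> * w) < 1"
    using la a_exp b_exp by (intro eventually_small; simp)+
  ultimately have "\<forall>\<^sub>F k in sequentially. False"
  proof eventually_elim
    case (elim k)
    define h where "h = H (Suc k)"
    have h: "0 < h" "1 < h" using H_gt1[of "Suc k"] by (auto simp: h_def)
    have pw: "(1/64 * h powr w) powr (- (e * \<nu>)) = 64 powr (e * \<nu>) * h powr (- (e * \<nu> * w))" for e
      using h by (simp add: powr_mult powr_divide powr_powr powr_minus field_simps)
    obtain p r n :: int where n: "0 < \<bar>n\<bar>" "\<bar>real_of_int n\<bar> \<le> 1/64 * h powr w"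
      and e1: "\<bar>n * \<theta>1 - p\<bar> \<le> 64 powr (a * \<nu>) * h powr (- (a * \<nu> * w))"
      and e2: "\<bar>n * \<theta>2 - r\<bar> \<le> 64 powr (b * \<nu>) * h powr (- (b * \<nu> * w))"
      using elim(1) unfolding h_def[symmetric] pw by blast
    have vanish: "n * z m - p * x m - r * y m = 0"
      if m: "\<bar>L m\<bar> \<le> 16 * h powr (- w)" "x m \<le> 3/2 * h powr a" "y m \<le> 3/2 * h powr s" for m
    proof -
      have "\<bar>n * L m\<bar> \<le> (1/64 * h powr w) * (16 * h powr (- w))"
        unfolding abs_mult using n m by (intro mult_mono) auto
      also have "\<dots> = 1/4" using h by (simp add: powr_minus)
      finally have "\<bar>n * L m\<bar> \<le> 1/4" .
      moreover have "\<bar>(n * \<theta>1 - p) * x m\<bar> < 1/4"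
      proof -
        have "\<bar>(n * \<theta>1 - p) * x m\<bar> \<le> (64 powr (a * \<nu>) * h powr (- (a * \<nu> * w))) * (3/2 * h powr a)"
          unfolding abs_mult using e1 m x_pos[of m] by (intro mult_mono) auto
        also have "\<dots> < 1/4"
          using elim(2) unfolding h_def[symmetric] by (simp add: powr_diff powr_minus field_simps)
        finally show ?thesis .
      qed
      moreover have "\<bar>(n * \<theta>2 - r) * y m\<bar> < 1/4"
      proof -
        have "\<bar>(n * \<theta>2 - r) * y m\<bar> \<le> (64 powr (b * \<nu>) * h powr (- (b * \<nu> * w))) * (3/2 * h powr s)"
          unfolding abs_mult using e2 m y_pos[of m] by (intro mult_mono) auto
        also have "\<dots> < 1/4"
          using elim(3) unfolding h_def[symmetric] by (simp add: powr_diff powr_minus field_simps)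
        finally show ?thesis .
      qed
      ultimately have "\<bar>real_of_int (n * z m - p * x m - r * y m)\<bar> < 1"
        unfolding dual_pairing_eq by linarith
      then show ?thesis by linarith
    qed
    have "n * z k - p * x k - r * y k = 0"
      using L_bounds(1)[of k] x_le[of k] y_le[of k] by (intro vanish) (auto simp: h_def)
    moreover have "n * z (k+1) - p * x (k+1) - r * y (k+1) = 0"
    proof (rule vanish)
      have "H (Suc (Suc k)) powr (- w) \<le> h powr (- w)"
        using powr_mono2'[of "- w" h "H (Suc (Suc k))"] H_mono[of "Suc k"] w_pos h unfolding h_def by simp
      then show "\<bar>L (k+1)\<bar> \<le> 16 * h powr (- w)" using L_bounds(1)[of "k+1"] by simp
    qed (use x_upper[of "k+1"] y_upper[of "k+1"] in \<open>simp_all add: h_def\<close>)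
    ultimately obtain m where m: "n = m * N k" "p = m * R k" "r = m * S k"
      by (rule dual_vector_multiple)
    have "1 \<le> real_of_int \<bar>m\<bar>" using n(1) m(1) by (cases "m = 0") auto
    then have "1 * \<bar>N k * \<theta>1 - R k\<bar> \<le> \<bar>m\<bar> * \<bar>N k * \<theta>1 - R k\<bar>"
      by (intro mult_right_mono) auto
    also have "\<dots> = \<bar>n * \<theta>1 - p\<bar>"
      unfolding m of_int_abs abs_mult[symmetric] by (simp add: algebra_simps)
    finally have "\<bar>N k * \<theta>1 - R k\<bar> \<le> \<bar>n * \<theta>1 - p\<bar>"
      by (simp only: mult_1)
    from order_trans[OF error_bounds(2)[of k] order_trans[OF this e1]]
    have "h powr (s - w) / 64 \<le> 64 powr (a * \<nu>) * h powr (- (a * \<nu> * w))"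
      unfolding h_def .
    moreover have "64 * (64 powr (a * \<nu>) * h powr (- (a * \<nu> * w))) < h powr (s - w)"
      using elim(4) h unfolding h_def[symmetric] by (simp add: powr_diff powr_minus powr_add field_simps)
    ultimately show False by simp
  qed
  then show False by simp
qed

lemma lambda_hat_eq: "lambda_hat (a / 2) (b / 2) (\<theta>1, \<theta>2) = ereal l"
  unfolding lambda_hat_def
  using lambda_attained lambda_not_exceeded by (intro Sup_ereal_eqI l_pos) simp_all

end


section \<open>Uncountably many limit points\<close>

lemma uncountable_bool_sequences: "uncountable (UNIV :: (nat \<Rightarrow> bool) set)"
proof
  assume "countable (UNIV :: (nat \<Rightarrow> bool) set)"
  then have "range (from_nat_into UNIV) = (UNIV :: (nat \<Rightarrow> bool) set)"
    by (intro range_from_nat_into) auto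
  from surjD[OF this, of "\<lambda>n. \<not> from_nat_into UNIV n n"]
  obtain m where m: "(\<lambda>n. \<not> from_nat_into UNIV n n) = (from_nat_into UNIV m :: nat \<Rightarrow> bool)"
    by blast
  show False using fun_cong[OF m, of m] by simp
qed

text \<open>
  \<open>H k = B powr (g ^ k)\<close> with \<open>B\<close> so large that even the smallest of the exponents \<open>1\<close>, \<open>s\<close>,
  \<open>a - s\<close> gives growth by the factor \<open>1000\<close> in every step.
\<close>

lemma power_growth_exists:
  fixes a s g :: real
  assumes "0 < s" "s < a" "2 < g"
  shows "\<exists>H :: nat \<Rightarrow> real. (\<forall>k. 1 < H k) \<and> (\<forall>k. H (Suc k) = H k powr g) \<and>
    filterlim H at_top sequentially \<and> fast_growth (\<lambda>k. H k powr a) (\<lambda>k. H k powr s)"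
proof -
  define c where "c = min 1 (min s (a - s))"
  have c: "0 < c" "c \<le> 1" "c \<le> s" "c \<le> a - s" using assms by (auto simp: c_def)
  define B :: real where "B = 1000 powr (1 / c)"
  define H where "H k = B powr (g ^ k)" for k
  have B: "B powr c = 1000" "1 < B"
    using c by (simp_all add: B_def powr_powr)
  have H_Suc: "H (Suc k) = H k powr g" for k
    by (simp add: H_def powr_powr mult.commute)
  have H_ge: "B \<le> H k" for k
    using powr_mono[of 1 "g ^ k" B] B assms one_le_power[of g k] by (simp add: H_def)
  then have H_gt1: "1 < H k" for k using B less_le_trans by blast
  have grow: "1000 * H k powr e \<le> H (Suc k) powr e" if "c \<le> e" for k e
  proof -
    have "1 * e \<le> (g - 1) * e" using assms that c by (intro mult_right_mono) auto
    then have e: "c \<le> (g - 1) * e" using that by simp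
    have "1000 = B powr c" using B by simp
    also have "\<dots> \<le> H k powr c" using H_ge[of k] B c by (intro powr_mono2) auto
    also have "\<dots> \<le> H k powr ((g - 1) * e)" using H_gt1[of k] e by (intro powr_mono) auto
    finally have "1000 * H k powr e \<le> H k powr ((g - 1) * e) * H k powr e"
      by (intro mult_right_mono) auto
    also have "\<dots> = H (Suc k) powr e"
      by (simp add: H_Suc powr_powr powr_add[symmetric] algebra_simps)
    finally show ?thesis .
  qed
  have "real k \<le> H k" for k
  proof (induction k)
    case 0
    then show ?case using H_gt1[of 0] by simp
  next
    case (Suc k)
    then show ?case using grow[of 1 k] c H_gt1[of k] H_gt1[of "Suc k"] by simp
  qed
  then have lim: "filterlim H at_top sequentially"
    by (intro filterlim_at_top_mono[OF filterlim_real_sequentially]) simp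
  have "fast_growth (\<lambda>k. H k powr a) (\<lambda>k. H k powr s)"
  proof
    fix k
    show "1 \<le> H k powr a" "1 \<le> H k powr s"
      using H_gt1[of k] assms by (simp_all add: ge_one_powr_ge_zero)
    show "1000 * H k powr a \<le> H (Suc k) powr a" "1000 * H k powr s \<le> H (Suc k) powr s"
      using c assms by (intro grow; simp)+
    have "1000 * H k powr (a - s) * (H k powr s * H (Suc k) powr s) \<le>
        H (Suc k) powr (a - s) * (H k powr s * H (Suc k) powr s)"
      using grow[OF c(4)] by (intro mult_right_mono) auto
    then show "1000 * (H k powr a * H (Suc k) powr s) \<le> H (Suc k) powr a * H k powr s"
      using H_gt1[of k] H_gt1[of "Suc k"] by (simp add: powr_diff field_simps)
  qed
  then show ?thesis using H_gt1 H_Suc lim by blast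
qed

theorem theorem4:
  fixes i j w l :: real
  assumes "i \<ge> 0" and "j \<ge> 0" and "i > j" and "i + j = 1"
    and "w > 6 * i"
    and "l \<in> {1 / (2 * i) * (1 - 2 * j / w) <..<
                min (1 / (2 * i)) (1 / (2 * j) * (1 - 2 * i / w))}"
  shows "uncountable {\<theta> :: real \<times> real. indep_over_rat \<theta> \<and>
           omega_hat i j \<theta> = ereal w \<and> lambda_hat i j \<theta> = ereal l}"
proof -
  define a b where "a = 2 * i" and "b = 2 * j"
  have a: "1 < a" "a + b = 2" "3 * a < w" and b0: "0 \<le> b"
    using assms by (auto simp: a_def b_def)
  have w: "0 < w" using a by linarith
  have l: "1 / a * (1 - b / w) < l" "l < 1 / a" "l < 1 / b * (1 - a / w)"
    using assms(6) by (auto simp: a_def b_def)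
  \<comment> \<open>for \<open>b = 0\<close> the upper bound \<open>1 / b * (1 - a / w)\<close> is \<open>0\<close> by the convention \<open>1 / 0 = 0\<close>, and the interval is empty\<close>
  have b: "0 < b"
  proof (rule ccontr)
    assume "\<not> 0 < b"
    then have "b = 0" using b0 by simp
    then show False using l a by auto
  qed
  define s where "s = w * (1 - a * l)"
  define g where "g = w * l"
  have s: "0 < s" "s < b"
  proof -
    have "a * l < 1" using l(2) a by (simp add: field_simps)
    then show "0 < s" using w by (simp add: s_def)
    show "s < b" using l(1) a w by (simp add: s_def field_simps)
  qed
  have s_less_a: "s < a" using s a by linarith
  have g: "2 < g"
  proof -
    have "a * g = w - s" by (simp add: s_def g_def algebra_simps)
    then have "a * 2 < a * g" using s a by linarith
    then show ?thesis using a by simp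
  qed
  have lb: "b * l * w < w - a" using l(3) b w by (simp add: field_simps)
  obtain H where H: "\<forall>k. 1 < H k" "\<forall>k. H (Suc k) = H k powr g" "filterlim H at_top sequentially"
    "fast_growth (\<lambda>k. H k powr a) (\<lambda>k. H k powr s)"
    using power_growth_exists[OF s(1) s_less_a g] by blast
  interpret G: fast_growth "\<lambda>k. H k powr a" "\<lambda>k. H k powr s" by (rule H(4))
  \<comment> \<open>\<open>case_nat 0\<close> keeps the choice at index \<open>0\<close> fixed, as \<open>chain_limit_inj\<close> demands\<close>
  define f where "f \<epsilon> = G.chain_limit (case_nat 0 (\<lambda>n. if \<epsilon> n then 1 else 0))" for \<epsilon> :: "nat \<Rightarrow> bool"
  have \<eta>: "case_nat 0 (\<lambda>n. if \<epsilon> n then 1 else 0) k \<in> {0, 1::int}" for \<epsilon> k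
    by (cases k) auto
  have "inj f"
  proof (rule injI, rule ccontr)
    fix \<epsilon> \<epsilon>' assume eq: "f \<epsilon> = f \<epsilon>'" and "\<epsilon> \<noteq> \<epsilon>'"
    then obtain n where n: "\<epsilon> n \<noteq> \<epsilon>' n" by blast
    have "case_nat 0 (\<lambda>n. if \<epsilon> n then 1 else (0::int)) \<noteq> case_nat 0 (\<lambda>n. if \<epsilon>' n then 1 else 0)"
    proof
      assume "case_nat 0 (\<lambda>n. if \<epsilon> n then 1 else (0::int)) = case_nat 0 (\<lambda>n. if \<epsilon>' n then 1 else 0)"
      from fun_cong[OF this, of "Suc n"] show False
        using n by (simp split: if_splits)
    qed
    then have "f \<epsilon> \<noteq> f \<epsilon>'"
      unfolding f_def by (intro G.chain_limit_inj \<eta>) auto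
    then show False using eq by simp
  qed
  then have "uncountable (range f)"
    using uncountable_bool_sequences by (auto dest: countable_image_inj_on)
  moreover have "range f \<subseteq> {\<theta>. indep_over_rat \<theta> \<and> omega_hat i j \<theta> = ereal w \<and> lambda_hat i j \<theta> = ereal l}"
  proof (rule image_subsetI, rule CollectI, intro conjI)
    fix \<epsilon>
    let ?v = "chain (\<lambda>k. H k powr a) (\<lambda>k. H k powr s) (case_nat 0 (\<lambda>n. if \<epsilon> n then 1 else 0))"
    interpret P: power_chain "\<lambda>k. H (k+3)" a s "\<lambda>k. fst (?v (k+3))" "\<lambda>k. fst (snd (?v (k+3)))"
      "\<lambda>k. snd (snd (?v (k+3)))" b w g l
    proof (intro power_chain.intro power_chain_axioms.intro G.approx_chain_exists \<eta>)
      show "filterlim (\<lambda>k. H (k+3)) at_top sequentially"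
        using filterlim_compose[OF H(3) filterlim_add_const_nat_at_top] .
      fix k show "H (Suc k + 3) = H (k+3) powr g" using H(2)[rule_format, of "k+3"] by simp
      show "w = s + a * g" "a * l * w = w - s" by (simp_all add: s_def g_def algebra_simps)
    qed (use H a b s g lb in auto)
    have "f \<epsilon> = (P.\<theta>1, P.\<theta>2)" by (simp add: f_def G.chain_limit_def)
    then show "indep_over_rat (f \<epsilon>)" "omega_hat i j (f \<epsilon>) = ereal w" "lambda_hat i j (f \<epsilon>) = ereal l"
      using P.independent P.omega_hat_eq P.lambda_hat_eq by (simp_all add: a_def b_def)
  qed
  ultimately show ?thesis
    using countable_subset by blast
qed

end
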